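(* Let $(X,\Gamma)$ be a Kazhdan graph structure with $X$ a connected $k$-regular graph. Let $(X_i)_{i\in I}$ be a family of finite connected $k$-regular graphs, each covered by $X$ via a covering map $p_i\colon X\to X_i$, and suppose that for each $i\in I$ either (i) $\Gamma\subseteq \mathrm{Cov}(X,X_i)$, or (ii) $\mathrm{Cov}(X,X_i)$ is a subgroup of finite index in $\Gamma$. Then $(X_i)_{i\in I}$ is a family of expanders. Furthermore, the expanding constant $c$ depends (only) on the Kazhdan constant of the group $\Gamma$.
   Context: A group $\Gamma$ has Kazhdan's property (T) if there exist a finite subset $Q\subseteq\Gamma$ and $\varepsilon>0$ such that every unitary representation $(\pi,\mathcal H)$ of $\Gamma$ having a vector $\xi\neq 0$ with $\sup_{x\in Q}\|\pi(x)\xi-\xi\|<\varepsilon\|\xi\|$ has a nonzero $\Gamma$-invariant vector. A Kazhdan graph structure is a pair $(X,\Gamma)$ where $X$ is a (locally finite) regular graph and $\Gamma$ is a subgroup of the automorphism group $\mathrm{Aut}(X)$ such that: the orbit space $V(X)/\Gamma$ is finite; every vertex stabilizer $\Gamma_x$ ($x\in V(X)$) is finite; and $\Gamma$ has property (T). For connected graphs $X_1,X_2$, a covering map $p\colon X_2\to X_1$ is a map on vertices such that $u\sim v$ in $X_2$ implies $p(u)\sim p(v)$ in $X_1$, and for every vertex $u$ of $X_2$ the restriction of $p$ to the neighbourhood of $u$ is a bijection onto the neighbourhood of $p(u)$. The group of covering transformations $\mathrm{Cov}(X_2,X_1)=\mathrm{Cov}(p)$ consists of the graph automorphisms $\alpha$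 of $X_2$ with $p\circ\alpha=p$. A finite $d$-regular graph with $n$ vertices is an $(n,d,c)$-expander if for every subset $A$ of vertices, $|\partial A|\ge c(1-|A|/n)|A|$, where $\partial A$ is the set of vertices at distance exactly $1$ from $A$. A family of finite $d$-regular graphs is a family of expanders if there is a single $c>0$ such that each member is an $(n,d,c)$-expander ($n$ its number of vertices); equivalently, the second largest eigenvalue of the Markov (normalized adjacency) operator is bounded above by $1-\varepsilon$ for a uniform $\varepsilon>0$.
   Formalization: That c depends only on the Kazhdan constant is literally false (trivial group on n-cycles, c→0); here c is a function of a Kazhdan constant ε for a finite set Q, the degree k, the number of Γ-orbits on V(X), and a bound on how far Q moves some vertex, independent of the family. *)

theory Defs
  imports Complex_Main "HOL-Algebra.Group_Action" "HOL-Algebra.Module"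
begin

section \<open>Complex Hilbert spaces and unitary representations\<close>

definition complex_field :: "complex ring" where
  "complex_field = \<lparr>carrier = UNIV, mult = (*), one = 1, zero = 0, add = (+)\<rparr>"

text \<open>The fields \<open>mult\<close> and \<open>one\<close>, which modules inherit from the ring record, are not used.\<close>

record 'h inner_space = "(complex, 'h) module" +
  cinner :: "'h \<Rightarrow> 'h \<Rightarrow> complex"

definition hnorm :: "('h, 'm) inner_space_scheme \<Rightarrow> 'h \<Rightarrow> real" where
  "hnorm H v = sqrt (Re (cinner H v v))"

locale hilbert_space = module complex_field H for H (structure) +
  assumes cinner_add_left: "\<lbrakk>u \<in> carrier H; v \<in> carrier H; w \<in> carrier H\<rbrakk>
      \<Longrightarrow> cinner H (u \<oplus>\<^bsub>H\<^esub> v) w = cinner H u w + cinner H v w"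
    and cinner_smult_left: "\<lbrakk>u \<in> carrier H; v \<in> carrier H\<rbrakk>
      \<Longrightarrow> cinner H (a \<odot>\<^bsub>H\<^esub> u) v = a * cinner H u v"
    and cinner_commute: "\<lbrakk>u \<in> carrier H; v \<in> carrier H\<rbrakk>
      \<Longrightarrow> cinner H u v = cnj (cinner H v u)"
    and cinner_pos: "\<lbrakk>u \<in> carrier H; u \<noteq> \<zero>\<^bsub>H\<^esub>\<rbrakk> \<Longrightarrow> Re (cinner H u u) > 0"
    and complete: "\<lbrakk>\<And>n::nat. s n \<in> carrier H;
        \<And>e. e > 0 \<Longrightarrow> \<exists>N. \<forall>m\<ge>N. \<forall>n\<ge>N. hnorm H (s m \<ominus>\<^bsub>H\<^esub> s n) < e\<rbrakk>
      \<Longrightarrow> \<exists>l\<in>carrier H. (\<lambda>n. hnorm H (s n \<ominus>\<^bsub>H\<^esub> l)) \<longlonglongrightarrow> 0"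

definition unitaries :: "('h, 'm) inner_space_scheme \<Rightarrow> ('h \<Rightarrow> 'h) set" where
  "unitaries H = {U \<in> Bij (carrier H).
     (\<forall>u\<in>carrier H. \<forall>v\<in>carrier H. U (u \<oplus>\<^bsub>H\<^esub> v) = U u \<oplus>\<^bsub>H\<^esub> U v) \<and>
     (\<forall>a. \<forall>u\<in>carrier H. U (a \<odot>\<^bsub>H\<^esub> u) = a \<odot>\<^bsub>H\<^esub> U u) \<and>
     (\<forall>u\<in>carrier H. \<forall>v\<in>carrier H. cinner H (U u) (U v) = cinner H u v)}"

definition unitary_group :: "('h, 'm) inner_space_scheme \<Rightarrow> ('h \<Rightarrow> 'h) monoid" where
  "unitary_group H = BijGroup (carrier H) \<lparr>carrier := unitaries H\<rparr>"

definition unitary_rep ::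
    "('g, 'n) monoid_scheme \<Rightarrow> 'h inner_space \<Rightarrow> ('g \<Rightarrow> 'h \<Rightarrow> 'h) \<Rightarrow> bool" where
  "unitary_rep G H \<pi> \<longleftrightarrow> hilbert_space H \<and> \<pi> \<in> hom G (unitary_group H)"


section \<open>Property (T)\<close>

text \<open>
  HOL cannot quantify over the types of Hilbert spaces inside a formula, so \<open>kazhdan_pair\<close> lets
  \<open>H\<close> range over all Hilbert spaces whose carrier is a set of elements of the fixed type
  \<open>'g \<times> nat \<Rightarrow> complex\<close>; the operations and the inner product are arbitrary.  This is no
  restriction: the type contains the square-summable functions on \<open>'g \<times> nat\<close>, hence isomorphic
  copies of all Hilbert spaces of Hilbert dimension at most that of this one.  In a representation
  of \<open>G\<close> on any Hilbert space, the closed span of the orbit of \<open>\<xi>\<close> is a subrepresentation of such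
  a dimension; it contains \<open>\<xi>\<close>, and an invariant vector of it is one of the full representation.

  As \<open>Q\<close> is finite, \<open>sup\<^bsub>x \<in> Q\<^esub> \<parallel>\<pi>(x)\<xi> - \<xi>\<parallel> < \<epsilon>\<parallel>\<xi>\<parallel>\<close> is a bound for each \<open>x \<in> Q\<close>
  (with \<open>sup \<emptyset> = 0\<close>).
\<close>

definition kazhdan_pair :: "('g, 'n) monoid_scheme \<Rightarrow> 'g set \<Rightarrow> real \<Rightarrow> bool" where
  "kazhdan_pair G Q \<epsilon> \<longleftrightarrow> finite Q \<and> Q \<subseteq> carrier G \<and> \<epsilon> > 0 \<and>
     (\<forall>(H :: ('g \<times> nat \<Rightarrow> complex) inner_space) \<pi>. unitary_rep G H \<pi> \<longrightarrow>
        (\<exists>\<xi>\<in>carrier H. \<xi> \<noteq> \<zero>\<^bsub>H\<^esub> \<and> (\<forall>x\<in>Q. hnorm H (\<pi> x \<xi> \<ominus>\<^bsub>H\<^esub> \<xi>) < \<epsilon> * hnorm H \<xi>)) \<longrightarrow>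
        (\<exists>\<eta>\<in>carrier H. \<eta> \<noteq> \<zero>\<^bsub>H\<^esub> \<and> (\<forall>g\<in>carrier G. \<pi> g \<eta> = \<eta>)))"

definition property_T :: "('g, 'n) monoid_scheme \<Rightarrow> bool" where
  "property_T G \<longleftrightarrow> group G \<and> (\<exists>Q \<epsilon>. kazhdan_pair G Q \<epsilon>)"


section \<open>Graphs\<close>

record 'v ugraph =
  verts :: "'v set"
  adj :: "'v \<Rightarrow> 'v \<Rightarrow> bool"

definition simple_graph :: "'v ugraph \<Rightarrow> bool" where
  "simple_graph X \<longleftrightarrow>
     (\<forall>u v. adj X u v \<longrightarrow> u \<in> verts X \<and> v \<in> verts X \<and> u \<noteq> v \<and> adj X v u)"

definition neighbors :: "'v ugraph \<Rightarrow> 'v \<Rightarrow> 'v set" where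
  "neighbors X u = {v. adj X u v}"

definition regular :: "'v ugraph \<Rightarrow> nat \<Rightarrow> bool" where
  "regular X k \<longleftrightarrow> (\<forall>u\<in>verts X. finite (neighbors X u) \<and> card (neighbors X u) = k)"

definition connected_graph :: "'v ugraph \<Rightarrow> bool" where
  "connected_graph X \<longleftrightarrow>
     verts X \<noteq> {} \<and> (\<forall>u\<in>verts X. \<forall>v\<in>verts X. rtranclp (adj X) u v)"

text \<open>Meaningful only for vertices joined by a path.\<close>

definition graph_dist :: "'v ugraph \<Rightarrow> 'v \<Rightarrow> 'v \<Rightarrow> nat" where
  "graph_dist X u v = (LEAST n. (adj X ^^ n) u v)"

definition graph_auts :: "'v ugraph \<Rightarrow> ('v \<Rightarrow> 'v) set" where
  "graph_auts X = {\<alpha> \<in> Bij (verts X).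
     \<forall>u\<in>verts X. \<forall>v\<in>verts X. adj X (\<alpha> u) (\<alpha> v) \<longleftrightarrow> adj X u v}"

definition aut_group :: "'v ugraph \<Rightarrow> ('v \<Rightarrow> 'v) monoid" where
  "aut_group X = BijGroup (verts X) \<lparr>carrier := graph_auts X\<rparr>"

abbreviation aut_subgroup :: "'v ugraph \<Rightarrow> ('v \<Rightarrow> 'v) set \<Rightarrow> ('v \<Rightarrow> 'v) monoid" where
  "aut_subgroup X \<Gamma> \<equiv> aut_group X \<lparr>carrier := \<Gamma>\<rparr>"

definition orbit_space :: "'v ugraph \<Rightarrow> ('v \<Rightarrow> 'v) set \<Rightarrow> 'v set set" where
  "orbit_space X \<Gamma> = orbits (aut_subgroup X \<Gamma>) (verts X) (\<lambda>\<gamma>. \<gamma>)"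

definition kazhdan_graph_structure :: "'v ugraph \<Rightarrow> ('v \<Rightarrow> 'v) set \<Rightarrow> bool" where
  "kazhdan_graph_structure X \<Gamma> \<longleftrightarrow>
     simple_graph X \<and> (\<exists>k. regular X k) \<and>
     subgroup \<Gamma> (aut_group X) \<and>
     finite (orbit_space X \<Gamma>) \<and>
     (\<forall>x\<in>verts X. finite (stabilizer (aut_subgroup X \<Gamma>) (\<lambda>\<gamma>. \<gamma>) x)) \<and>
     property_T (aut_subgroup X \<Gamma>)"

definition covering_map :: "'v ugraph \<Rightarrow> 'w ugraph \<Rightarrow> ('v \<Rightarrow> 'w) \<Rightarrow> bool" where
  "covering_map X Y p \<longleftrightarrow>
     p ` verts X \<subseteq> verts Y \<and>
     (\<forall>u v. adj X u v \<longrightarrow> adj Y (p u) (p v)) \<and>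
     (\<forall>u\<in>verts X. bij_betw p (neighbors X u) (neighbors Y (p u)))"

definition Cov :: "'v ugraph \<Rightarrow> ('v \<Rightarrow> 'w) \<Rightarrow> ('v \<Rightarrow> 'v) set" where
  "Cov X p = {\<alpha> \<in> graph_auts X. \<forall>u\<in>verts X. p (\<alpha> u) = p u}"

definition finite_index_subgroup :: "'g set \<Rightarrow> ('g, 'n) monoid_scheme \<Rightarrow> bool" where
  "finite_index_subgroup H G \<longleftrightarrow> subgroup H G \<and> finite (rcosets\<^bsub>G\<^esub> H)"


section \<open>Expanders\<close>

definition boundary :: "'v ugraph \<Rightarrow> 'v set \<Rightarrow> 'v set" where
  "boundary X A = {v \<in> verts X - A. \<exists>u\<in>A. adj X u v}"

definition expander :: "'v ugraph \<Rightarrow> nat \<Rightarrow> nat \<Rightarrow> real \<Rightarrow> bool" where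
  "expander X n d c \<longleftrightarrow>
     simple_graph X \<and> finite (verts X) \<and> card (verts X) = n \<and> regular X d \<and>
     (\<forall>A\<subseteq>verts X. real (card (boundary X A)) \<ge> c * (1 - real (card A) / real n) * real (card A))"

definition expanders_with_constant :: "real \<Rightarrow> nat \<Rightarrow> 'i set \<Rightarrow> ('i \<Rightarrow> 'w ugraph) \<Rightarrow> bool" where
  "expanders_with_constant c d I Y \<longleftrightarrow> (\<forall>i\<in>I. expander (Y i) (card (verts (Y i))) d c)"

definition expander_family :: "nat \<Rightarrow> 'i set \<Rightarrow> ('i \<Rightarrow> 'w ugraph) \<Rightarrow> bool" where
  "expander_family d I Y \<longleftrightarrow> (\<exists>c>0. expanders_with_constant c d I Y)"

text \<open>
  The expanding constant is a function \<open>C k m r \<epsilon>\<close> of the Kazhdan constant: \<open>\<epsilon>\<close> is a Kazhdan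
  constant of \<open>\<Gamma>\<close> for the finite set \<open>Q\<close>, and the other arguments normalise it against the action
  on \<open>X\<close>: the degree \<open>k\<close>, the number \<open>m\<close> of orbits, and a bound \<open>r\<close> on the displacement by \<open>Q\<close>
  of some vertex.  No constant can be independent of all of these.  The trivial group has
  \<open>({1}, 1)\<close> as Kazhdan pair and acts on every cycle (\<open>m\<close> is unbounded).  The rotation group of
  the \<open>n\<close>-cycle, with \<open>Q\<close> the whole group, is transitive and has a Kazhdan constant independent
  of \<open>n\<close> (\<open>r\<close> is unbounded).
\<close>

end

theory Submission
  imports Defs "HOL-Library.Indicator_Function"
begin

text \<open>
  Let \<open>\<Lambda> = Cov(X, Y)\<close>.  If \<open>\<Gamma> \<subseteq> \<Lambda>\<close>, then \<open>Y\<close> has at most as many vertices as there are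
  \<open>\<Gamma>\<close>-orbits, so any boundary point gives enough expansion.

  If \<open>\<Lambda>\<close> has finite index in \<open>\<Gamma>\<close>, lift a function \<open>f\<close> on \<open>Y\<close> to the \<open>\<Lambda>\<close>-invariant function
  \<open>F = f \<circ> p\<close>.  Each vertex \<open>x\<close> of \<open>X\<close> gives a function \<open>\<xi>\<^sub>x(\<Lambda>\<gamma>) = F(\<gamma>x)\<close> on the finite set
  \<open>\<Lambda>\<setminus>\<Gamma>\<close>, and right translation by \<open>g\<close> sends \<open>\<xi>\<^sub>x\<close> to \<open>\<xi>\<^bsub>gx\<^esub>\<close>.  As \<open>\<Gamma>\<close> is transitive on
  \<open>\<Lambda>\<setminus>\<Gamma>\<close>, the functions of sum zero contain no invariant vector, so property (T) bounds the variance of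
  \<open>\<xi>\<^sub>x\<close> by \<open>\<parallel>\<xi>\<^bsub>qx\<^esub> - \<xi>\<^sub>x\<parallel>\<^sup>2 / \<epsilon>\<^sup>2\<close> for some \<open>q \<in> Q\<close>.  Along a path from \<open>x\<close> to \<open>qx\<close> this is
  bounded by the Dirichlet energy of \<open>f\<close>.

  Neither stabilizers nor the degree \<open>D\<close> of \<open>\<Lambda>\<setminus>X \<rightarrow> Y\<close> are bounded, but they cancel: \<open>\<Lambda>\<close> acts
  freely, so \<open>\<Lambda>\<gamma> \<mapsto> \<Lambda>\<gamma>x\<close> is exactly \<open>\<bar>\<Gamma>\<^sub>x\<bar>\<close>-to-one, the stabilizers of vertices at distance \<open>n\<close>
  differ by a factor of at most \<open>k\<^sup>n\<close>, and \<open>D\<close> is a common factor of both sides.  The result is a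
  Poincare inequality on \<open>Y\<close>, which yields expansion when \<open>f\<close> is an indicator function.
\<close>

section \<open>Finite permutation representations\<close>

text \<open>The orthogonal complement of the constants in the functions on \<open>T\<close>.
  Vanishing off \<open>T\<close> makes every vector one total function, so a nonzero vector has a
  nonzero value in \<open>T\<close>.\<close>

definition zero_sum_space :: "'a set \<Rightarrow> ('a \<Rightarrow> complex) inner_space" where
  "zero_sum_space T =
     \<lparr>carrier = {\<phi>. (\<forall>t. t \<notin> T \<longrightarrow> \<phi> t = 0) \<and> sum \<phi> T = 0},
      mult = (\<lambda>\<phi> \<psi> t. \<phi> t * \<psi> t), one = (\<lambda>t. 1), zero = (\<lambda>t. 0),
      add = (\<lambda>\<phi> \<psi> t. \<phi> t + \<psi> t), smult = (\<lambda>a \<phi> t. a * \<phi> t),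
      cinner = (\<lambda>\<phi> \<psi>. \<Sum>t\<in>T. \<phi> t * cnj (\<psi> t))\<rparr>"

lemma zero_sum_space_simps:
  "\<phi> \<in> carrier (zero_sum_space T) \<longleftrightarrow> (\<forall>t. t \<notin> T \<longrightarrow> \<phi> t = 0) \<and> sum \<phi> T = 0"
  "zero (zero_sum_space T) = (\<lambda>t. 0)"
  "add (zero_sum_space T) \<phi> \<psi> = (\<lambda>t. \<phi> t + \<psi> t)"
  "smult (zero_sum_space T) a \<phi> = (\<lambda>t. a * \<phi> t)"
  "cinner (zero_sum_space T) \<phi> \<psi> = (\<Sum>t\<in>T. \<phi> t * cnj (\<psi> t))"
  by (simp_all add: zero_sum_space_def)

lemma cring_complex_field: "cring complex_field"
proof (rule cringI)
  show "abelian_group complex_field"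
    by (rule abelian_groupI) (auto simp: complex_field_def intro: exI[of _ "- x" for x])
  show "comm_monoid complex_field"
    by (rule comm_monoidI) (auto simp: complex_field_def)
qed (simp add: complex_field_def algebra_simps)

lemma abelian_group_zero_sum_space: "abelian_group (zero_sum_space T)"
proof (rule abelian_groupI)
  fix \<phi> assume "\<phi> \<in> carrier (zero_sum_space T)"
  then show "\<exists>\<psi>\<in>carrier (zero_sum_space T).
      \<psi> \<oplus>\<^bsub>zero_sum_space T\<^esub> \<phi> = \<zero>\<^bsub>zero_sum_space T\<^esub>"
    by (intro bexI[of _ "\<lambda>t. - \<phi> t"]) (simp_all add: zero_sum_space_simps sum_negf)
qed (auto simp: zero_sum_space_simps sum.distrib)

lemma module_zero_sum_space: "module complex_field (zero_sum_space T)"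
  by (intro moduleI cring_complex_field abelian_group_zero_sum_space)
    (auto simp: zero_sum_space_simps complex_field_def algebra_simps
      simp flip: sum_distrib_left)

lemma minus_zero_sum_space:
  assumes "\<psi> \<in> carrier (zero_sum_space T)"
  shows "\<phi> \<ominus>\<^bsub>zero_sum_space T\<^esub> \<psi> = (\<lambda>t. \<phi> t - \<psi> t)"
proof -
  interpret abelian_group "zero_sum_space T" by (rule abelian_group_zero_sum_space)
  have "\<ominus>\<^bsub>zero_sum_space T\<^esub> \<psi> = (\<lambda>t. - \<psi> t)"
    using assms by (intro minus_equality) (simp_all add: zero_sum_space_simps sum_negf)
  then show ?thesis by (simp add: a_minus_def zero_sum_space_simps)
qed

lemma hnorm_zero_sum_space:
  "hnorm (zero_sum_space T) \<phi> = sqrt (\<Sum>t\<in>T. (cmod (\<phi> t))\<^sup>2)"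
  by (simp add: hnorm_def zero_sum_space_simps complex_mult_cnj cmod_power2)

text \<open>Completeness is coordinatewise: each coordinate is dominated by the norm, and since
  \<open>T\<close> is finite the pointwise limit is a limit in norm and still has sum zero.\<close>

lemma hilbert_space_zero_sum_space:
  assumes fin: "finite T"
  shows "hilbert_space (zero_sum_space T)"
proof (intro hilbert_space.intro hilbert_space_axioms.intro module_zero_sum_space)
  let ?H = "zero_sum_space T"
  show "Re (cinner ?H u u) > 0" if "u \<in> carrier ?H" "u \<noteq> \<zero>\<^bsub>?H\<^esub>" for u
  proof -
    from that obtain t where "u t \<noteq> 0" "t \<in> T" by (auto simp: zero_sum_space_simps fun_eq_iff)
    then have "(\<Sum>t\<in>T. (cmod (u t))\<^sup>2) > 0"
      by (intro sum_pos2[OF fin]) auto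
    then show ?thesis by (simp add: zero_sum_space_simps complex_mult_cnj cmod_power2)
  qed
  fix s :: "nat \<Rightarrow> 'a \<Rightarrow> complex"
  assume s: "\<And>n. s n \<in> carrier ?H"
    and cau: "\<And>e. e > 0 \<Longrightarrow> \<exists>N. \<forall>m\<ge>N. \<forall>n\<ge>N. hnorm ?H (s m \<ominus>\<^bsub>?H\<^esub> s n) < e"
  have conv: "convergent (\<lambda>n. s n t)" for t
  proof (cases "t \<in> T")
    case True
    have le: "cmod (s m t - s n t) \<le> hnorm ?H (s m \<ominus>\<^bsub>?H\<^esub> s n)" for m n
      unfolding hnorm_zero_sum_space minus_zero_sum_space[OF s]
      by (rule real_le_rsqrt) (rule member_le_sum[OF True _ fin], simp)
    have "Cauchy (\<lambda>n. s n t)"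
      unfolding Cauchy_def dist_norm using cau le by (meson le_less_trans)
    then show ?thesis by (rule Cauchy_convergent)
  next
    case False
    then have "s n t = 0" for n using s by (simp add: zero_sum_space_simps)
    then show ?thesis by (simp add: convergent_const)
  qed
  define l where "l t = lim (\<lambda>n. s n t)" for t
  have lim: "(\<lambda>n. s n t) \<longlonglongrightarrow> l t" for t
    unfolding l_def using conv convergent_LIMSEQ_iff by blast
  have "(\<lambda>n. sum (s n) T) \<longlonglongrightarrow> sum l T" by (intro tendsto_sum lim)
  moreover have "sum (s n) T = 0" for n using s by (simp add: zero_sum_space_simps)
  ultimately have "sum l T = 0" by (simp add: LIMSEQ_const_iff)
  moreover have "l t = 0" if "t \<notin> T" for t
    using that s lim[of t] by (simp add: zero_sum_space_simps LIMSEQ_const_iff)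
  ultimately have l: "l \<in> carrier ?H" by (simp add: zero_sum_space_simps)
  have "(\<lambda>n. sqrt (\<Sum>t\<in>T. (cmod (s n t - l t))\<^sup>2)) \<longlonglongrightarrow> sqrt (\<Sum>t\<in>T. (cmod (l t - l t))\<^sup>2)"
    by (intro tendsto_intros lim)
  then show "\<exists>l\<in>carrier ?H. (\<lambda>n. hnorm ?H (s n \<ominus>\<^bsub>?H\<^esub> l)) \<longlonglongrightarrow> 0"
    using l by (intro bexI[of _ l]) (simp_all add: hnorm_zero_sum_space minus_zero_sum_space)
qed (auto simp: zero_sum_space_simps sum.distrib sum_distrib_left algebra_simps)

text \<open>Property (T) read contrapositively for the permutation representation. By transitivity
  an invariant function is constant on \<open>T\<close>, and with sum zero it vanishes. There is
  thus no nonzero invariant vector, and \<open>u\<close> cannot be almost invariant under all of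
  \<open>Q\<close>.\<close>

lemma kazhdan_pair_permutation_gap:
  fixes G :: "('g, 'n) monoid_scheme" (structure)
    and T :: "('g \<times> nat) set" and u :: "'g \<times> nat \<Rightarrow> real"
  assumes "group G" and kazhdan: "kazhdan_pair G Q \<epsilon>" and fin: "finite T"
    and closed: "\<And>g t. g \<in> carrier G \<Longrightarrow> t \<in> T \<Longrightarrow> \<tau> g t \<in> T"
    and one: "\<And>t. t \<in> T \<Longrightarrow> \<tau> \<one>\<^bsub>G\<^esub> t = t"
    and mult: "\<And>g h t. g \<in> carrier G \<Longrightarrow> h \<in> carrier G \<Longrightarrow> t \<in> T \<Longrightarrow>
                 \<tau> (g \<otimes>\<^bsub>G\<^esub> h) t = \<tau> h (\<tau> g t)"
    and transitive: "\<And>s t. s \<in> T \<Longrightarrow> t \<in> T \<Longrightarrow> \<exists>g\<in>carrier G. \<tau> g s = t"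
    and u0: "sum u T = 0" and nz: "\<exists>t\<in>T. u t \<noteq> 0"
  shows "\<exists>q\<in>Q. \<epsilon>\<^sup>2 * (\<Sum>t\<in>T. (u t)\<^sup>2) \<le> (\<Sum>t\<in>T. (u (\<tau> q t) - u t)\<^sup>2)"
proof (rule ccontr)
  interpret group G by fact
  let ?H = "zero_sum_space T"
  assume neg: "\<not> ?thesis"
  have bij: "bij_betw (\<tau> g) T T" if g: "g \<in> carrier G" for g
  proof (rule bij_betw_byWitness[where f' = "\<tau> (inv g)"])
    show "\<forall>t\<in>T. \<tau> (inv g) (\<tau> g t) = t" using g mult[of g "inv g"] one by simp
    show "\<forall>t\<in>T. \<tau> g (\<tau> (inv g) t) = t" using g mult[of "inv g" g] one by simp
  qed (use g closed in auto)
  \<comment> \<open>Precomposition turns the right action \<open>\<tau>\<close> into a homomorphism.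
    The restriction to the carrier is there because \<open>Bij\<close> consists of extensional
    functions.\<close>
  define \<pi> where "\<pi> g = (\<lambda>\<phi>\<in>carrier ?H. \<lambda>t. if t \<in> T then \<phi> (\<tau> g t) else 0)" for g
  have sum_perm: "(\<Sum>t\<in>T. (if t \<in> T then h (\<tau> g t) else 0)) = sum h T"
    if "g \<in> carrier G" for g and h :: "'g \<times> nat \<Rightarrow> complex"
    using sum.reindex_bij_betw[OF bij[OF that], of h] by simp
  have maps: "\<pi> g \<phi> \<in> carrier ?H" if "g \<in> carrier G" "\<phi> \<in> carrier ?H" for g \<phi>
    using that sum_perm[of g \<phi>] by (simp add: \<pi>_def zero_sum_space_simps)
  have pi_mult: "\<pi> (g \<otimes> h) \<phi> = \<pi> g (\<pi> h \<phi>)"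
    if "g \<in> carrier G" "h \<in> carrier G" "\<phi> \<in> carrier ?H" for g h \<phi>
    using that maps[of h \<phi>] closed by (auto simp: \<pi>_def mult fun_eq_iff)
  have pi_one: "\<pi> \<one> \<phi> = \<phi>" if "\<phi> \<in> carrier ?H" for \<phi>
    using that one by (auto simp: \<pi>_def fun_eq_iff zero_sum_space_simps)
  have "bij_betw (\<pi> g) (carrier ?H) (carrier ?H)" if g: "g \<in> carrier G" for g
  proof (rule bij_betw_byWitness[where f' = "\<pi> (inv g)"])
    show "\<forall>\<phi>\<in>carrier ?H. \<pi> (inv g) (\<pi> g \<phi>) = \<phi>" "\<forall>\<phi>\<in>carrier ?H. \<pi> g (\<pi> (inv g) \<phi>) = \<phi>"
      using g pi_mult[of "inv g" g] pi_mult[of g "inv g"] pi_one by auto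
  qed (use g maps in auto)
  then have Bij: "\<pi> g \<in> Bij (carrier ?H)" if "g \<in> carrier G" for g
    using that by (simp add: Bij_def \<pi>_def)
  have unitary: "\<pi> g \<in> unitaries ?H" if g: "g \<in> carrier G" for g
  proof -
    have "cinner ?H (\<pi> g \<phi>) (\<pi> g \<psi>) = cinner ?H \<phi> \<psi>"
      if "\<phi> \<in> carrier ?H" "\<psi> \<in> carrier ?H" for \<phi> \<psi>
    proof -
      have "cinner ?H (\<pi> g \<phi>) (\<pi> g \<psi>) = (\<Sum>t\<in>T. if t \<in> T then \<phi> (\<tau> g t) * cnj (\<psi> (\<tau> g t)) else 0)"
        using that unfolding zero_sum_space_simps(5) by (intro sum.cong) (simp_all add: \<pi>_def)
      then show ?thesis
        using sum_perm[OF g, of "\<lambda>t. \<phi> t * cnj (\<psi> t)"] by (simp add: zero_sum_space_simps)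
    qed
    moreover have "\<phi> \<oplus>\<^bsub>?H\<^esub> \<psi> \<in> carrier ?H" "a \<odot>\<^bsub>?H\<^esub> \<phi> \<in> carrier ?H"
      if "\<phi> \<in> carrier ?H" "\<psi> \<in> carrier ?H" for a \<phi> \<psi>
      using that by (auto simp: zero_sum_space_simps sum.distrib simp flip: sum_distrib_left)
    ultimately show ?thesis
      using Bij[OF g] unfolding unitaries_def
      by (auto simp: \<pi>_def zero_sum_space_simps(3,4) fun_eq_iff)
  qed
  have "\<pi> \<in> hom G (unitary_group ?H)"
  proof (rule homI)
    fix g h assume g: "g \<in> carrier G" and h: "h \<in> carrier G"
    have "\<pi> (g \<otimes> h) = compose (carrier ?H) (\<pi> g) (\<pi> h)"
    proof (rule extensionalityI[of _ "carrier ?H"])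
      show "\<pi> (g \<otimes> h) \<phi> = compose (carrier ?H) (\<pi> g) (\<pi> h) \<phi>" if "\<phi> \<in> carrier ?H" for \<phi>
        using that pi_mult[OF g h] by (simp add: compose_def)
    qed (simp_all add: \<pi>_def)
    then show "\<pi> (g \<otimes> h) = \<pi> g \<otimes>\<^bsub>unitary_group ?H\<^esub> \<pi> h"
      using Bij g h by (simp add: unitary_group_def BijGroup_def)
  qed (simp add: unitary unitary_group_def)
  then have rep: "unitary_rep G ?H \<pi>"
    by (simp add: unitary_rep_def hilbert_space_zero_sum_space[OF fin])
  define \<xi> where "\<xi> t = (if t \<in> T then complex_of_real (u t) else 0)" for t
  have \<xi>: "\<xi> \<in> carrier ?H"
  proof -
    have "sum \<xi> T = complex_of_real (sum u T)" by (simp add: \<xi>_def)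
    then show ?thesis using u0 by (simp add: zero_sum_space_simps \<xi>_def)
  qed
  have \<xi>_nz: "\<xi> \<noteq> \<zero>\<^bsub>?H\<^esub>"
    using nz by (auto simp: zero_sum_space_simps \<xi>_def fun_eq_iff)
  have eps: "\<epsilon> > 0" and Q: "Q \<subseteq> carrier G" using kazhdan by (auto simp: kazhdan_pair_def)
  have "hnorm ?H (\<pi> q \<xi> \<ominus>\<^bsub>?H\<^esub> \<xi>) < \<epsilon> * hnorm ?H \<xi>" if "q \<in> Q" for q
  proof -
    have q: "q \<in> carrier G" using that Q by auto
    have "(\<Sum>t\<in>T. (u (\<tau> q t) - u t)\<^sup>2) < \<epsilon>\<^sup>2 * (\<Sum>t\<in>T. (u t)\<^sup>2)" using neg that by force
    moreover have "hnorm ?H (\<pi> q \<xi> \<ominus>\<^bsub>?H\<^esub> \<xi>) = sqrt (\<Sum>t\<in>T. (u (\<tau> q t) - u t)\<^sup>2)"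
      using closed[OF q] \<xi>
      by (simp add: hnorm_zero_sum_space minus_zero_sum_space \<pi>_def \<xi>_def cmod_power2 cong: sum.cong)
    moreover have "\<epsilon> * hnorm ?H \<xi> = sqrt (\<epsilon>\<^sup>2 * (\<Sum>t\<in>T. (u t)\<^sup>2))"
      using eps by (simp add: hnorm_zero_sum_space \<xi>_def real_sqrt_mult cong: sum.cong)
    ultimately show ?thesis by simp
  qed
  with kazhdan rep \<xi> \<xi>_nz obtain \<eta> where \<eta>: "\<eta> \<in> carrier ?H" "\<eta> \<noteq> \<zero>\<^bsub>?H\<^esub>"
    and inv: "\<And>g. g \<in> carrier G \<Longrightarrow> \<pi> g \<eta> = \<eta>"
    unfolding kazhdan_pair_def by blast
  \<comment> \<open>What remains is that an invariant \<open>\<eta>\<close> must be constant on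
    \<open>T\<close>, hence zero.\<close>
  from nz obtain s where s: "s \<in> T" by blast
  have const: "\<eta> t = \<eta> s" if t: "t \<in> T" for t
  proof -
    obtain g where g: "g \<in> carrier G" "\<tau> g s = t" using transitive[OF s t] by blast
    have "\<pi> g \<eta> s = \<eta> t" using \<eta> s g by (simp add: \<pi>_def)
    then show ?thesis using inv[OF g(1)] by simp
  qed
  have "of_nat (card T) * \<eta> s = 0"
    using \<eta>(1) const by (simp add: zero_sum_space_simps cong: sum.cong)
  then have "\<eta> s = 0" using fin s by (auto simp: card_eq_0_iff)
  then show False using \<eta> const by (auto simp: zero_sum_space_simps fun_eq_iff)
qed


section \<open>Groups acting on a connected graph\<close>

text \<open>The combinatorial side of a connected Kazhdan graph structure; property (T) enters
  later, through a \<open>kazhdan_pair\<close> for \<open>G\<close>.\<close>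

locale graph_group = group G for G :: "('v \<Rightarrow> 'v) monoid" (structure) +
  fixes X :: "'v ugraph" and \<Gamma> :: "('v \<Rightarrow> 'v) set" and k :: nat
  assumes G_eq: "G = aut_subgroup X \<Gamma>"
    and auts: "\<Gamma> \<subseteq> graph_auts X"
    and simple: "simple_graph X" and conn: "connected_graph X" and reg: "regular X k"
    and fin_orbits: "finite (orbit_space X \<Gamma>)"
    and fin_stab: "x \<in> verts X \<Longrightarrow> finite (stabilizer G (\<lambda>\<gamma>. \<gamma>) x)"
begin

abbreviation "stab \<equiv> stabilizer G (\<lambda>\<gamma>. \<gamma>)"

abbreviation "orb \<equiv> orbit G (\<lambda>\<gamma>. \<gamma>)"

lemma carrier_eq: "carrier G = \<Gamma>" by (simp add: G_eq)

lemma act_closed: "g \<in> carrier G \<Longrightarrow> x \<in> verts X \<Longrightarrow> g x \<in> verts X"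
  using auts Bij_imp_funcset[of g "verts X"] by (auto simp: carrier_eq graph_auts_def)

lemma act_mult: "g \<in> carrier G \<Longrightarrow> h \<in> carrier G \<Longrightarrow> x \<in> verts X \<Longrightarrow> (g \<otimes> h) x = g (h x)"
  using auts unfolding G_eq aut_group_def BijGroup_def graph_auts_def
  by (simp add: compose_def subset_iff)

lemma act_one: "x \<in> verts X \<Longrightarrow> \<one> x = x"
  by (simp add: G_eq aut_group_def BijGroup_def)

lemma act_inv:
  assumes "g \<in> carrier G" "x \<in> verts X"
  shows "(inv g) (g x) = x" "g ((inv g) x) = x"
proof -
  show "(inv g) (g x) = x"
    using act_mult[of "inv g" g x] act_one[of x] assms by simp
  show "g ((inv g) x) = x"
    using act_mult[of g "inv g" x] act_one[of x] assms by simp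
qed

lemma act_adj:
  "g \<in> carrier G \<Longrightarrow> x \<in> verts X \<Longrightarrow> y \<in> verts X \<Longrightarrow> adj X (g x) (g y) \<longleftrightarrow> adj X x y"
  using auts by (auto simp: carrier_eq graph_auts_def)

lemma adj_verts: "adj X x y \<Longrightarrow> x \<in> verts X" "adj X x y \<Longrightarrow> y \<in> verts X"
  and adj_sym: "adj X x y \<Longrightarrow> adj X y x"
  using simple by (auto simp: simple_graph_def)

lemma walk_verts: "(adj X ^^ n) x y \<Longrightarrow> x \<in> verts X \<Longrightarrow> y \<in> verts X"
  by (induction n arbitrary: y) (auto dest: adj_verts)

lemma in_stab: "g \<in> stab x \<longleftrightarrow> g \<in> carrier G \<and> g x = x"
  by (simp add: stabilizer_def)

section \<open>Sizes of stabilizers along walks\<close>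

lemma card_stab_pos:
  assumes "x \<in> verts X" shows "card (stab x) > 0"
proof -
  have "\<one> \<in> stab x" using assms act_one by (simp add: in_stab)
  then show ?thesis using fin_stab[OF assms] card_gt_0_iff by blast
qed

text \<open>If some \<open>g0\<close> carries \<open>x\<close> to \<open>u\<close>, left
  multiplication by \<open>inv g0\<close> embeds all such elements into the stabilizer of
  \<open>x\<close>.\<close>

lemma card_transporter_le:
  assumes x: "x \<in> verts X"
  shows "finite {g \<in> carrier G. g x = u} \<and> card {g \<in> carrier G. g x = u} \<le> card (stab x)"
proof (cases "\<exists>g0\<in>carrier G. g0 x = u")
  case True
  then obtain g0 where g0: "g0 \<in> carrier G" "g0 x = u" by blast
  let ?S = "{g \<in> carrier G. g x = u}"
  have inj: "inj_on (\<lambda>g. inv g0 \<otimes> g) ?S" using g0 by (auto intro!: inj_onI)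
  have "(\<lambda>g. inv g0 \<otimes> g) ` ?S \<subseteq> stab x"
    using g0 x act_inv(1)[OF g0(1) x] by (auto simp: in_stab act_mult)
  then show ?thesis
    using card_inj_on_le[OF inj] inj_on_finite[OF inj] fin_stab[OF x] by simp
next
  case False
  then have "{g \<in> carrier G. g x = u} = {}" by blast
  then show ?thesis by (metis card.empty finite.emptyI zero_le)
qed

text \<open>An automorphism fixing \<open>y\<close> sends its neighbour \<open>x\<close> to one of
  the \<open>k\<close> neighbours of \<open>y\<close>, and each target is reached by at most
  \<open>card (stab x)\<close> elements.\<close>

lemma card_stab_adj:
  assumes xy: "adj X x y"
  shows "card (stab y) \<le> k * card (stab x)"
proof -
  have x: "x \<in> verts X" and y: "y \<in> verts X" using adj_verts xy by auto
  have "stab y \<subseteq> (\<Union>u\<in>neighbors X y. {g \<in> carrier G. g x = u})"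
  proof
    fix g assume "g \<in> stab y"
    then have "g \<in> carrier G" "adj X (g y) (g x)" "g y = y"
      using act_adj[of g y x] adj_sym[OF xy] x y by (auto simp: in_stab)
    then show "g \<in> (\<Union>u\<in>neighbors X y. {g \<in> carrier G. g x = u})"
      by (auto simp: neighbors_def)
  qed
  moreover have fin: "finite (neighbors X y)" and "card (neighbors X y) = k"
    using reg y by (auto simp: regular_def)
  ultimately have "card (stab y) \<le> card (\<Union>u\<in>neighbors X y. {g \<in> carrier G. g x = u})"
    using card_transporter_le[OF x] by (intro card_mono) auto
  also have "\<dots> \<le> (\<Sum>u\<in>neighbors X y. card {g \<in> carrier G. g x = u})"
    by (rule card_UN_le[OF fin])
  also have "\<dots> \<le> (\<Sum>u\<in>neighbors X y. card (stab x))"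
    using card_transporter_le[OF x] by (intro sum_mono) blast
  finally show ?thesis using \<open>card (neighbors X y) = k\<close> by simp
qed

text \<open>The base \<open>k + 1\<close> is at least 1 even for \<open>k = 0\<close>, so the
  exponent can later be raised to a common bound.\<close>

lemma card_stab_walk:
  "(adj X ^^ n) x y \<Longrightarrow> card (stab y) \<le> (k + 1) ^ n * card (stab x)"
proof (induction n arbitrary: y)
  case (Suc n)
  then obtain z where z: "(adj X ^^ n) x z" "adj X z y" by auto
  have "card (stab y) \<le> k * card (stab z)" by (rule card_stab_adj[OF z(2)])
  also have "\<dots> \<le> (k + 1) * ((k + 1) ^ n * card (stab x))"
    using Suc.IH[OF z(1)] by (intro mult_mono) auto
  finally show ?case by (simp add: algebra_simps)
qed simp

lemma walk_sym: "(adj X ^^ n) x y \<Longrightarrow> (adj X ^^ n) y x"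
proof (induction n arbitrary: y)
  case (Suc n)
  then obtain z where "(adj X ^^ n) x z" "adj X z y" by auto
  then show ?case using Suc.IH adj_sym by (metis relpowp_Suc_I2)
qed simp

section \<open>Orbits and representatives close to a base vertex\<close>

lemma orbit_space_eq: "orbit_space X \<Gamma> = orb ` verts X"
  by (auto simp: orbit_space_def orbits_def G_eq)

lemma orbit_act:
  assumes "g \<in> carrier G" "x \<in> verts X"
  shows "orb (g x) = orb x"
proof (rule subset_antisym)
  show "orb (g x) \<subseteq> orb x"
  proof
    fix y assume "y \<in> orb (g x)"
    then obtain h where "h \<in> carrier G" "y = h (g x)" unfolding orbit_def by blast
    then show "y \<in> orb x"
      unfolding orbit_def using assms by (intro CollectI exI[of _ "h \<otimes> g"]) (simp add: act_mult)
  qed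
  show "orb x \<subseteq> orb (g x)"
  proof
    fix y assume "y \<in> orb x"
    then obtain h where "h \<in> carrier G" "y = h x" unfolding orbit_def by blast
    then show "y \<in> orb (g x)"
      unfolding orbit_def using assms act_closed[OF assms] act_inv(1)[OF assms]
      by (intro CollectI exI[of _ "h \<otimes> inv g"]) (simp add: act_mult)
  qed
qed

lemma mem_orbit_self: "x \<in> verts X \<Longrightarrow> x \<in> orb x"
  unfolding orbit_def by (intro CollectI exI[of _ \<one>]) (simp add: act_one)

text \<open>The set of orbits met by the ball of radius \<open>n\<close> grows with \<open>n\<close> until it contains every orbit,
  because once it is stationary it is closed under adjacency.\<close>

lemma orbit_meets_ball:
  assumes x0: "x0 \<in> verts X" and x: "x \<in> verts X"
  shows "\<exists>n y. n \<le> card (orbit_space X \<Gamma>) \<and> (adj X ^^ n) x0 y \<and> x \<in> orb y"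
proof -
  define B where "B n = orb ` {y. \<exists>j\<le>n. (adj X ^^ j) x0 y}" for n
  have sub: "B n \<subseteq> orbit_space X \<Gamma>" for n
    unfolding B_def orbit_space_eq using walk_verts x0 by blast
  have mono: "B n \<subseteq> B (Suc n)" for n
    unfolding B_def using le_SucI by blast
  have closed: "B n = orbit_space X \<Gamma>" if st: "B (Suc n) = B n" for n
  proof -
    have "orb y \<in> B n" if "(adj X)\<^sup>*\<^sup>* x0 y" for y
      using that
    proof (induction rule: rtranclp_induct)
      case base
      have "(adj X ^^ 0) x0 x0" by simp
      then show ?case unfolding B_def by blast
    next
      case (step y z)
      from step.IH obtain j w where w: "j \<le> n" "(adj X ^^ j) x0 w" "orb y = orb w"
        unfolding B_def by auto
      have yz: "y \<in> verts X" "z \<in> verts X" and wV: "w \<in> verts X"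
        using step.hyps adj_verts walk_verts w x0 by auto
      have "w \<in> orb y" using mem_orbit_self[OF wV] w(3) by simp
      then obtain g where g: "g \<in> carrier G" "w = g y"
        unfolding orbit_def by auto
      \<comment> \<open>Translating the edge from \<open>y\<close> to \<open>z\<close> by
        \<open>g\<close> gives an edge at \<open>w\<close>, which lies in the ball; the new endpoint
        is in the orbit of \<open>z\<close>.\<close>
      have "adj X w (g z)" using g step.hyps(2) yz act_adj by simp
      then have "(adj X ^^ Suc j) x0 (g z)" using w(2) by (meson relpowp_Suc_I)
      then have "orb (g z) \<in> B (Suc n)" unfolding B_def using w(1) by blast
      then show ?case using orbit_act g(1) yz(2) st by simp
    qed
    then show ?thesis
      using sub[of n] conn x0 unfolding orbit_space_eq connected_graph_def
      by (intro subset_antisym image_subsetI) simp_all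
  qed
  \<comment> \<open>Every strict growth gains an orbit, so for \<open>n\<close> equal to the number
    of orbits the second alternative is impossible.\<close>
  have "B n = orbit_space X \<Gamma> \<or> n < card (B n)" for n
  proof (induction n)
    case 0
    have "B 0 = {orb x0}" unfolding B_def by simp
    then show ?case by simp
  next
    case (Suc n)
    show ?case
    proof (cases "B (Suc n) = B n")
      case True
      then show ?thesis using closed by simp
    next
      case False
      then have "B n \<subset> B (Suc n)" using mono by blast
      then have "card (B n) < card (B (Suc n))"
        using fin_orbits sub finite_subset psubset_card_mono by metis
      moreover have "B n \<noteq> orbit_space X \<Gamma>" using \<open>B n \<subset> B (Suc n)\<close> sub by blast
      ultimately show ?thesis using Suc by linarith
    qed
  qed
  then have "B (card (orbit_space X \<Gamma>)) = orbit_space X \<Gamma>"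
    using card_mono[OF fin_orbits sub] leD by blast
  then have "orb x \<in> B (card (orbit_space X \<Gamma>))" using x orbit_space_eq by auto
  then obtain n y where "n \<le> card (orbit_space X \<Gamma>)" "(adj X ^^ n) x0 y" "orb x = orb y"
    unfolding B_def by auto
  moreover have "x \<in> orb y" using mem_orbit_self[OF x] calculation by simp
  ultimately show ?thesis by blast
qed

text \<open>One representative per orbit, taken from the ball around \<open>x0\<close>. The bounds
  on their number and on the walks to them are what make the final constant depend on the number of
  orbits and not on \<open>Y\<close>.\<close>

lemma orbit_representatives:
  assumes x0: "x0 \<in> verts X"
  shows "\<exists>S. finite S \<and> card S \<le> card (orbit_space X \<Gamma>) \<and>
    (\<forall>y\<in>S. \<exists>n\<le>card (orbit_space X \<Gamma>). (adj X ^^ n) x0 y) \<and>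
    (\<forall>x\<in>verts X. \<exists>y\<in>S. x \<in> orb y)"
proof -
  let ?m = "card (orbit_space X \<Gamma>)"
  have "\<forall>A\<in>orbit_space X \<Gamma>. \<exists>y. (\<exists>n\<le>?m. (adj X ^^ n) x0 y) \<and> A = orb y"
  proof
    fix A assume "A \<in> orbit_space X \<Gamma>"
    then obtain x where x: "x \<in> verts X" and Ox: "A = orb x"
      unfolding orbit_space_eq by blast
    obtain n y where n: "n \<le> ?m" "(adj X ^^ n) x0 y" and xy: "x \<in> orb y"
      using orbit_meets_ball[OF x0 x] by blast
    have "A = orb y"
    proof -
      obtain g where "g \<in> carrier G" "x = g y" using xy unfolding orbit_def by blast
      then show ?thesis using orbit_act[of g y] walk_verts[OF n(2) x0] Ox by simp
    qed
    then show "\<exists>y. (\<exists>n\<le>?m. (adj X ^^ n) x0 y) \<and> A = orb y" using n by blast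
  qed
  from bchoice[OF this] obtain pick where pick: "\<forall>A\<in>orbit_space X \<Gamma>.
      (\<exists>n\<le>?m. (adj X ^^ n) x0 (pick A)) \<and> A = orb (pick A)" ..
  show ?thesis
  proof (intro exI[of _ "pick ` orbit_space X \<Gamma>"] conjI ballI)
    show "card (pick ` orbit_space X \<Gamma>) \<le> ?m" by (rule card_image_le[OF fin_orbits])
    show "\<exists>y\<in>pick ` orbit_space X \<Gamma>. x \<in> orb y" if x: "x \<in> verts X" for x
    proof -
      have "orb x \<in> orbit_space X \<Gamma>" using x orbit_space_eq by blast
      then show ?thesis using pick mem_orbit_self[OF x] by blast
    qed
  qed (use fin_orbits pick in auto)
qed

end


section \<open>Finite-index groups of covering transformations\<close>

locale finite_index_covering = graph_group G X \<Gamma> k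
  for G :: "('v \<Rightarrow> 'v) monoid" (structure) and X :: "'v ugraph" and \<Gamma> k +
  fixes Y :: "'w ugraph" and p :: "'v \<Rightarrow> 'w"
  assumes covering: "covering_map X Y p"
    and Y_simple: "simple_graph Y" and Y_finite: "finite (verts Y)"
    and Y_conn: "connected_graph Y" and Y_reg: "regular Y k"
    and index: "finite_index_subgroup (Cov X p) G"
begin

abbreviation "\<Lambda> \<equiv> Cov X p"

lemma Cov_subgroup: "subgroup \<Lambda> G"
  using index by (simp add: finite_index_subgroup_def)

lemma Cov_carrier: "a \<in> \<Lambda> \<Longrightarrow> a \<in> carrier G"
  using subgroup.mem_carrier[OF Cov_subgroup] .

lemma p_Cov: "a \<in> \<Lambda> \<Longrightarrow> x \<in> verts X \<Longrightarrow> p (a x) = p x"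
  by (simp add: Cov_def)

lemma p_verts: "x \<in> verts X \<Longrightarrow> p x \<in> verts Y"
  using covering by (auto simp: covering_map_def)

lemma p_adj: "adj X x y \<Longrightarrow> adj Y (p x) (p y)"
  using covering by (auto simp: covering_map_def)

lemma p_inj: "adj X x y \<Longrightarrow> adj X x z \<Longrightarrow> p y = p z \<Longrightarrow> y = z"
  using covering adj_verts(1)[of x y]
  by (auto simp: covering_map_def bij_betw_def neighbors_def dest: inj_onD)

lemma p_lift:
  assumes "x \<in> verts X" "adj Y (p x) w" obtains y where "adj X x y" "p y = w"
proof -
  have "w \<in> p ` neighbors X x"
    using covering assms by (auto simp: covering_map_def bij_betw_def neighbors_def)
  then show thesis using that by (auto simp: neighbors_def)
qed

section \<open>Freeness of the action of covering transformations\<close>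

text \<open>Uniqueness of lifts: if \<open>y\<close> is fixed and \<open>z\<close> is adjacent to
  it, then \<open>z\<close> and \<open>a z\<close> are neighbours of \<open>y\<close> with the same
  image under \<open>p\<close>, hence equal. Connectedness spreads this to all vertices.\<close>

lemma Cov_fixed_point:
  assumes a: "a \<in> \<Lambda>" and x: "x \<in> verts X" and fixed: "a x = x"
  shows "a = \<one>"
proof -
  have aG: "a \<in> carrier G" using Cov_carrier[OF a] .
  have all: "a y = y" if "(adj X)\<^sup>*\<^sup>* x y" for y
    using that
  proof (induction rule: rtranclp_induct)
    case base show ?case by (rule fixed)
  next
    case (step y z)
    have "adj X y (a z)"
      using act_adj[OF aG adj_verts(1) adj_verts(2), OF step.hyps(2) step.hyps(2)] step by simp
    from p_inj[OF this step.hyps(2) p_Cov[OF a adj_verts(2)[OF step.hyps(2)]]] show ?case .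
  qed
  show ?thesis
  proof (rule extensionalityI[of _ "verts X"])
    show "a \<in> extensional (verts X)"
      using a Bij_imp_extensional by (auto simp: Cov_def graph_auts_def)
    show "\<one> \<in> extensional (verts X)" by (simp add: G_eq aut_group_def BijGroup_def)
    show "a y = \<one> y" if "y \<in> verts X" for y
      using that all[of y] conn x act_one by (auto simp: connected_graph_def)
  qed
qed

lemma Cov_free:
  assumes a: "a \<in> \<Lambda>" and b: "b \<in> \<Lambda>" and x: "x \<in> verts X" and eq: "a x = b x"
  shows "a = b"
proof -
  have G: "a \<in> carrier G" "b \<in> carrier G" using a b Cov_carrier by auto
  have "inv b \<otimes> a \<in> \<Lambda>"
    using a b Cov_subgroup by (simp add: subgroup.m_closed subgroup.m_inv_closed)
  moreover have "(inv b \<otimes> a) x = x" using G x act_inv(1)[of b x] eq by (simp add: act_mult)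
  ultimately have "inv b \<otimes> a = \<one>" using Cov_fixed_point x by blast
  then show ?thesis using G inv_solve_left[of "\<one>" b a] by simp
qed

section \<open>Representatives of the cosets of \<open>\<Lambda>\<close> in \<open>G\<close>\<close>

text \<open>Chosen elements replace the right cosets, so that a coset can be applied to a vertex and
  the index set consists of group elements, as the type in \<open>kazhdan_pair\<close> asks.\<close>

definition coset_rep :: "('v \<Rightarrow> 'v) \<Rightarrow> ('v \<Rightarrow> 'v)" where
  "coset_rep g = (SOME h. h \<in> \<Lambda> #> g)"

definition transversal :: "('v \<Rightarrow> 'v) set" where
  "transversal = coset_rep ` carrier G"

lemma coset_rep_obtain:
  assumes "g \<in> carrier G" obtains a where "a \<in> \<Lambda>" "coset_rep g = a \<otimes> g"
proof -
  have "g \<in> \<Lambda> #> g" using rcos_self[OF assms Cov_subgroup] .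
  then have "coset_rep g \<in> \<Lambda> #> g" unfolding coset_rep_def by (rule someI[of "\<lambda>h. h \<in> \<Lambda> #> g"])
  then show thesis using that by (auto simp: r_coset_def)
qed

lemma coset_rep_carrier: "g \<in> carrier G \<Longrightarrow> coset_rep g \<in> carrier G"
  by (rule coset_rep_obtain[of g]) (simp_all add: Cov_carrier)

lemma coset_rep_Cov_mult:
  assumes "a \<in> \<Lambda>" "g \<in> carrier G" shows "coset_rep (a \<otimes> g) = coset_rep g"
proof -
  have "\<Lambda> #> (a \<otimes> g) = (\<Lambda> #> a) #> g"
    using assms Cov_carrier subgroup.subset[OF Cov_subgroup] by (simp add: coset_mult_assoc)
  also have "\<Lambda> #> a = \<Lambda>" using assms Cov_carrier Cov_subgroup coset_join2 by blast
  finally show ?thesis by (simp add: coset_rep_def)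
qed

text \<open>This makes \<open>t \<mapsto> coset_rep (t \<otimes> h)\<close> a right action on the
  transversal: a left factor from \<open>\<Lambda>\<close> survives right multiplication and is then
  forgotten.\<close>

lemma coset_rep_mult:
  assumes "g \<in> carrier G" "h \<in> carrier G"
  shows "coset_rep (coset_rep g \<otimes> h) = coset_rep (g \<otimes> h)"
proof -
  obtain a where a: "a \<in> \<Lambda>" "coset_rep g = a \<otimes> g" using coset_rep_obtain[OF assms(1)] .
  then have "coset_rep g \<otimes> h = a \<otimes> (g \<otimes> h)" using assms Cov_carrier by (simp add: m_assoc)
  then show ?thesis using a assms coset_rep_Cov_mult by simp
qed

lemma p_coset_rep:
  assumes "g \<in> carrier G" "x \<in> verts X" shows "p (coset_rep g x) = p (g x)"
proof -
  obtain a where a: "a \<in> \<Lambda>" "coset_rep g = a \<otimes> g" using coset_rep_obtain[OF assms(1)] .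
  then show ?thesis
    using assms Cov_carrier[OF a(1)] p_Cov[OF a(1) act_closed[OF assms]] by (simp add: act_mult)
qed

lemma transversal_carrier: "t \<in> transversal \<Longrightarrow> t \<in> carrier G"
  using coset_rep_carrier by (auto simp: transversal_def)

lemma coset_rep_transversal: "t \<in> transversal \<Longrightarrow> coset_rep t = t"
  unfolding transversal_def using coset_rep_mult[of _ \<one>] by (auto simp: coset_rep_carrier)

lemma coset_rep_in: "g \<in> carrier G \<Longrightarrow> coset_rep g \<in> transversal"
  by (simp add: transversal_def)

lemma finite_transversal: "finite transversal"
proof -
  have "transversal \<subseteq> (\<lambda>C. SOME h. h \<in> C) ` (rcosets \<Lambda>)"
    unfolding transversal_def coset_rep_def RCOSETS_def by blast
  then show ?thesis
    using index finite_subset unfolding finite_index_subgroup_def by blast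
qed

lemma transversal_nonempty: "transversal \<noteq> {}"
  unfolding transversal_def by blast

section \<open>The quotient of \<open>X\<close> by \<open>\<Lambda>\<close> and its projection to
  \<open>Y\<close>\<close>

definition cov_orbit :: "'v \<Rightarrow> 'v set" where "cov_orbit x = (\<lambda>a. a x) ` \<Lambda>"

definition quotient :: "'v set set" where "quotient = cov_orbit ` verts X"

text \<open>The choice is harmless on \<open>quotient\<close>, because \<open>p\<close> is constant
  on the orbits of \<open>\<Lambda>\<close>.\<close>

definition proj :: "'v set \<Rightarrow> 'w" where "proj z = p (SOME x. x \<in> z)"

lemma cov_orbit_eq_iff:
  assumes x: "x \<in> verts X" and y: "y \<in> verts X"
  shows "cov_orbit x = cov_orbit y \<longleftrightarrow> (\<exists>a\<in>\<Lambda>. y = a x)"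
proof
  assume eq: "cov_orbit x = cov_orbit y"
  have "\<one> \<in> \<Lambda>" using subgroup.one_closed[OF Cov_subgroup] .
  then have "\<one> y \<in> cov_orbit y" unfolding cov_orbit_def by (rule imageI)
  then have "y \<in> cov_orbit x" using eq act_one[OF y] by simp
  then show "\<exists>a\<in>\<Lambda>. y = a x" unfolding cov_orbit_def by blast
next
  assume "\<exists>a\<in>\<Lambda>. y = a x"
  then obtain a where a: "a \<in> \<Lambda>" "y = a x" by blast
  have aG: "a \<in> carrier G" using Cov_carrier a by blast
  show "cov_orbit x = cov_orbit y"
  proof
    show "cov_orbit y \<subseteq> cov_orbit x"
    proof
      fix z assume "z \<in> cov_orbit y"
      then obtain b where b: "b \<in> \<Lambda>" "z = b y" unfolding cov_orbit_def by blast
      then have "z = (b \<otimes> a) x" using a(2) aG Cov_carrier x by (simp add: act_mult)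
      moreover have "b \<otimes> a \<in> \<Lambda>" using a b subgroup.m_closed[OF Cov_subgroup] by blast
      ultimately show "z \<in> cov_orbit x" unfolding cov_orbit_def by blast
    qed
    show "cov_orbit x \<subseteq> cov_orbit y"
    proof
      fix z assume "z \<in> cov_orbit x"
      then obtain b where b: "b \<in> \<Lambda>" "z = b x" unfolding cov_orbit_def by blast
      have "inv a \<in> \<Lambda>" using a subgroup.m_inv_closed[OF Cov_subgroup] by blast
      then have "b \<otimes> inv a \<in> \<Lambda>" using b subgroup.m_closed[OF Cov_subgroup] by blast
      moreover have "z = (b \<otimes> inv a) y"
        using b aG Cov_carrier[OF b(1)] y act_inv(1)[OF aG x] a(2) by (simp add: act_mult)
      ultimately show "z \<in> cov_orbit y" unfolding cov_orbit_def by blast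
    qed
  qed
qed

lemma cov_orbit_act:
  assumes a: "a \<in> \<Lambda>" and x: "x \<in> verts X" shows "cov_orbit (a x) = cov_orbit x"
proof -
  have "\<exists>b\<in>\<Lambda>. a x = b x" by (rule bexI[OF refl a])
  then show ?thesis using cov_orbit_eq_iff[OF x act_closed[OF Cov_carrier[OF a] x]] by simp
qed

lemma cov_orbit_eqE:
  assumes "cov_orbit x = cov_orbit y" "x \<in> verts X" "y \<in> verts X"
  obtains a where "a \<in> \<Lambda>" "y = a x"
proof -
  have "\<exists>a\<in>\<Lambda>. y = a x" using cov_orbit_eq_iff[OF assms(2,3)] assms(1) by (rule iffD1)
  then show thesis using that by (elim bexE)
qed

lemma proj_cov_orbit: "x \<in> verts X \<Longrightarrow> proj (cov_orbit x) = p x"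
proof -
  assume x: "x \<in> verts X"
  have "\<one> x \<in> cov_orbit x"
    unfolding cov_orbit_def using subgroup.one_closed[OF Cov_subgroup] by (rule imageI)
  then have "(SOME y. y \<in> cov_orbit x) \<in> cov_orbit x" by (rule someI[of "\<lambda>y. y \<in> cov_orbit x"])
  then obtain a where "a \<in> \<Lambda>" "(SOME y. y \<in> cov_orbit x) = a x" unfolding cov_orbit_def by blast
  then show ?thesis unfolding proj_def using p_Cov[OF _ x, of a] by simp
qed

text \<open>The cosets sending \<open>x\<close> into the \<open>\<Lambda>\<close>-orbit of
  \<open>t0 x\<close> are those of \<open>t0 \<otimes> s\<close> with \<open>s\<close> in the
  stabilizer of \<open>x\<close>. Freeness of \<open>\<Lambda>\<close> makes them distinct, so the
  count is exact.\<close>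

lemma card_transversal_cov_orbit:
  assumes x: "x \<in> verts X" and t0: "t0 \<in> transversal"
  shows "card {t \<in> transversal. cov_orbit (t x) = cov_orbit (t0 x)} = card (stab x)"
proof -
  have t0G: "t0 \<in> carrier G" using transversal_carrier t0 .
  have t0x: "t0 x \<in> verts X" using act_closed[OF t0G x] .
  have "bij_betw (\<lambda>s. coset_rep (t0 \<otimes> s)) (stab x)
          {t \<in> transversal. cov_orbit (t x) = cov_orbit (t0 x)}"
    unfolding bij_betw_def
  proof (intro conjI inj_onI subset_antisym subsetI)
    fix s s' assume s: "s \<in> stab x" "s' \<in> stab x"
      and eq: "coset_rep (t0 \<otimes> s) = coset_rep (t0 \<otimes> s')"
    have G: "s \<in> carrier G" "s' \<in> carrier G" and sx: "s x = x" "s' x = x"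
      using s by (auto simp: stabilizer_def)
    obtain a where a: "a \<in> \<Lambda>" "coset_rep (t0 \<otimes> s) = a \<otimes> (t0 \<otimes> s)"
      using coset_rep_obtain[OF m_closed[OF t0G G(1)]] .
    obtain b where b: "b \<in> \<Lambda>" "coset_rep (t0 \<otimes> s') = b \<otimes> (t0 \<otimes> s')"
      using coset_rep_obtain[OF m_closed[OF t0G G(2)]] .
    have ab: "a \<in> carrier G" "b \<in> carrier G" using a b Cov_carrier by auto
    have e: "a \<otimes> (t0 \<otimes> s) = b \<otimes> (t0 \<otimes> s')" using eq a b by simp
    \<comment> \<open>Evaluation at \<open>x\<close> removes \<open>s\<close> and \<open>s'\<close>,
      which leaves \<open>a\<close> and \<open>b\<close> agreeing at \<open>t0 x\<close>.\<close>
    then have "(a \<otimes> (t0 \<otimes> s)) x = (b \<otimes> (t0 \<otimes> s')) x" by simp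
    then have "a (t0 x) = b (t0 x)" using ab G t0G x sx by (simp add: act_mult)
    then have "a = b" by (rule Cov_free[OF a(1) b(1) t0x])
    then have "t0 \<otimes> s = t0 \<otimes> s'" using e ab G t0G by simp
    then show "s = s'" using G t0G by simp
  next
    fix t assume "t \<in> (\<lambda>s. coset_rep (t0 \<otimes> s)) ` stab x"
    then obtain s where s: "s \<in> carrier G" "s x = x" and t: "t = coset_rep (t0 \<otimes> s)"
      by (auto simp: stabilizer_def)
    obtain a where a: "a \<in> \<Lambda>" "t = a \<otimes> (t0 \<otimes> s)"
      using coset_rep_obtain[OF m_closed[OF t0G s(1)]] unfolding t .
    have aG: "a \<in> carrier G" using Cov_carrier a by blast
    then have tx: "t x = a (t0 x)" using a s t0G x by (simp add: act_mult)
    have "cov_orbit (t x) = cov_orbit (t0 x)" unfolding tx by (rule cov_orbit_act[OF a(1) t0x])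
    then show "t \<in> {t \<in> transversal. cov_orbit (t x) = cov_orbit (t0 x)}"
      using t coset_rep_in t0G s by simp
  next
    fix t assume "t \<in> {t \<in> transversal. cov_orbit (t x) = cov_orbit (t0 x)}"
    then have t: "t \<in> transversal" and eq: "cov_orbit (t0 x) = cov_orbit (t x)" by auto
    have tG: "t \<in> carrier G" using transversal_carrier t .
    have tx: "t x \<in> verts X" using act_closed[OF tG x] .
    obtain a where a: "a \<in> \<Lambda>" "t x = a (t0 x)" using cov_orbit_eqE[OF eq t0x tx] .
    have aG: "a \<in> carrier G" using Cov_carrier a by blast
    \<comment> \<open>The solution of \<open>t = a \<otimes> (t0 \<otimes> s)\<close>.\<close>
    define s where "s = inv t0 \<otimes> (inv a \<otimes> t)"
    have sG: "s \<in> carrier G" unfolding s_def using aG t0G tG by simp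
    have "s x = x"
      unfolding s_def using aG t0G tG x a(2) act_inv(1)[OF aG t0x] act_inv(1)[OF t0G x]
      by (simp add: act_mult)
    then have s: "s \<in> stab x" using sG by (simp add: stabilizer_def)
    have "t0 \<otimes> s = inv a \<otimes> t" unfolding s_def using aG t0G tG by (simp flip: m_assoc)
    moreover have "inv a \<in> \<Lambda>" using a subgroup.m_inv_closed[OF Cov_subgroup] by blast
    ultimately have "coset_rep (t0 \<otimes> s) = t"
      using coset_rep_Cov_mult tG coset_rep_transversal t by simp
    then show "t \<in> (\<lambda>s. coset_rep (t0 \<otimes> s)) ` stab x" using s by (intro image_eqI[OF sym])
  qed
  then show ?thesis using bij_betw_same_card by force
qed

lemma sum_transversal:
  fixes U :: "'v set \<Rightarrow> real"
  assumes x: "x \<in> verts X"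
  shows "(\<Sum>t\<in>transversal. U (cov_orbit (t x)))
       = card (stab x) * sum U ((\<lambda>t. cov_orbit (t x)) ` transversal)"
proof -
  have "(\<Sum>t\<in>transversal. U (cov_orbit (t x)))
      = (\<Sum>z\<in>(\<lambda>t. cov_orbit (t x)) ` transversal.
           \<Sum>t\<in>{t \<in> transversal. cov_orbit (t x) = z}. U (cov_orbit (t x)))"
    by (rule sum.image_gen[OF finite_transversal])
  also have "\<dots> = (\<Sum>z\<in>(\<lambda>t. cov_orbit (t x)) ` transversal. card (stab x) * U z)"
    by (rule sum.cong[OF refl]) (auto simp: card_transversal_cov_orbit[OF x])
  finally show ?thesis by (simp add: sum_distrib_left)
qed

lemma cov_orbit_coset_rep:
  assumes "g \<in> carrier G" "x \<in> verts X" shows "cov_orbit (coset_rep g x) = cov_orbit (g x)"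
proof -
  obtain a where a: "a \<in> \<Lambda>" "coset_rep g = a \<otimes> g" using coset_rep_obtain[OF assms(1)] .
  have "coset_rep g x = a (g x)" using a assms Cov_carrier[OF a(1)] by (simp add: act_mult)
  then show ?thesis using cov_orbit_act[OF a(1) act_closed[OF assms]] by simp
qed

lemma quotient_cover:
  assumes "\<forall>x\<in>verts X. \<exists>y\<in>S. x \<in> orb y" and "S \<subseteq> verts X"
  shows "quotient \<subseteq> (\<Union>y\<in>S. (\<lambda>t. cov_orbit (t y)) ` transversal)"
proof
  fix z assume "z \<in> quotient"
  then obtain x where x: "x \<in> verts X" "z = cov_orbit x" unfolding quotient_def by blast
  then obtain y where yS: "y \<in> S" "x \<in> orb y" using assms(1) by blast
  then obtain g where y: "y \<in> S" "g \<in> carrier G" "x = g y" unfolding orbit_def by blast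
  then have "z = cov_orbit (coset_rep g y)" using cov_orbit_coset_rep x assms(2) by auto
  then show "z \<in> (\<Union>y\<in>S. (\<lambda>t. cov_orbit (t y)) ` transversal)" using y coset_rep_in by blast
qed

lemma finite_quotient: "finite quotient"
proof -
  obtain x0 where x0: "x0 \<in> verts X" using conn by (auto simp: connected_graph_def)
  from orbit_representatives[OF x0]
  obtain S where S: "finite S" "\<forall>y\<in>S. \<exists>n\<le>card (orbit_space X \<Gamma>). (adj X ^^ n) x0 y"
    "\<forall>x\<in>verts X. \<exists>y\<in>S. x \<in> orb y"
    by (elim exE conjE)
  have "S \<subseteq> verts X" using S(2) walk_verts[OF _ x0] by blast
  from quotient_cover[OF S(3) this]
  have "quotient \<subseteq> (\<Union>y\<in>S. (\<lambda>t. cov_orbit (t y)) ` transversal)" by blast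
  moreover have "finite (\<Union>y\<in>S. (\<lambda>t. cov_orbit (t y)) ` transversal)"
    by (intro finite_UN_I S(1) finite_imageI finite_transversal)
  ultimately show ?thesis by (rule finite_subset)
qed

lemma quotient_sub: "x \<in> verts X \<Longrightarrow> (\<lambda>t. cov_orbit (t x)) ` transversal \<subseteq> quotient"
  unfolding quotient_def using act_closed[OF transversal_carrier] by auto

section \<open>The degree of the quotient over \<open>Y\<close>\<close>

text \<open>Lifting the edge from \<open>v\<close> to \<open>w\<close> at each vertex over
  \<open>v\<close> gives a map \<open>\<tau>\<close> between the fibres of \<open>p\<close>. It
  commutes with \<open>\<Lambda>\<close> because lifts are unique, so it descends to the fibres of
  \<open>proj\<close>; lifting the reversed edge shows that the descended map is injective.\<close>

lemma card_quotient_adj_le: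
  assumes vw: "adj Y v w"
  shows "card {z \<in> quotient. proj z = v} \<le> card {z \<in> quotient. proj z = w}"
proof -
  define \<tau> where "\<tau> x = (SOME y. adj X x y \<and> p y = w)" for x
  have \<tau>: "adj X x (\<tau> x) \<and> p (\<tau> x) = w" if x: "x \<in> verts X" "p x = v" for x
  proof -
    have "adj Y (p x) w" using vw x(2) by simp
    then obtain y where "adj X x y" "p y = w" using p_lift[OF x(1)] by blast
    then show ?thesis unfolding \<tau>_def by (intro someI[of "\<lambda>y. adj X x y \<and> p y = w" y] conjI)
  qed
  have \<tau>_Cov: "\<tau> (a x) = a (\<tau> x)" if a: "a \<in> \<Lambda>" and x: "x \<in> verts X" "p x = v" for a x
  proof -
    have aG: "a \<in> carrier G" using Cov_carrier a .
    have ax: "a x \<in> verts X" "p (a x) = v" using act_closed[OF aG x(1)] p_Cov[OF a x(1)] x by auto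
    have \<tau>x: "\<tau> x \<in> verts X" using \<tau>[OF x] adj_verts(2) by blast
    have "adj X (a x) (a (\<tau> x))" using act_adj[OF aG x(1) \<tau>x] \<tau>[OF x] by simp
    moreover have "p (a (\<tau> x)) = w" using p_Cov[OF a \<tau>x] \<tau>[OF x] by simp
    ultimately show ?thesis using p_inj[of "a x" "\<tau> (a x)" "a (\<tau> x)"] \<tau>[OF ax] by simp
  qed
  have image: "\<tau> ` cov_orbit x = cov_orbit (\<tau> x)" if x: "x \<in> verts X" "p x = v" for x
    unfolding cov_orbit_def image_image using \<tau>_Cov[OF _ x] by (rule image_cong[OF refl])
  show ?thesis
  proof (rule card_inj_on_le[where f = "image \<tau>"])
    show "inj_on (image \<tau>) {z \<in> quotient. proj z = v}"
    proof (rule inj_onI)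
      fix z z' assume z: "z \<in> {z \<in> quotient. proj z = v}" "z' \<in> {z \<in> quotient. proj z = v}"
        and eq: "\<tau> ` z = \<tau> ` z'"
      obtain x where x: "x \<in> verts X" "p x = v" "z = cov_orbit x"
        using z(1) unfolding quotient_def by (auto simp: proj_cov_orbit)
      obtain y where y: "y \<in> verts X" "p y = v" "z' = cov_orbit y"
        using z(2) unfolding quotient_def by (auto simp: proj_cov_orbit)
      have \<tau>V: "\<tau> x \<in> verts X" "\<tau> y \<in> verts X" using \<tau> x y adj_verts(2) by blast+
      have "cov_orbit (\<tau> x) = cov_orbit (\<tau> y)" using eq image x y by simp
      then obtain a where a: "a \<in> \<Lambda>" "\<tau> y = a (\<tau> x)" using cov_orbit_eqE[OF _ \<tau>V] by blast
      have ax: "a x \<in> verts X" "p (a x) = v"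
        using act_closed[OF Cov_carrier[OF a(1)] x(1)] p_Cov[OF a(1) x(1)] x by auto
      have "\<tau> y = \<tau> (a x)" using a \<tau>_Cov x by simp
      \<comment> \<open>Both \<open>y\<close> and \<open>a x\<close> are neighbours of
        \<open>\<tau> y\<close> over \<open>v\<close>, so they coincide.\<close>
      then have "adj X (\<tau> y) y" "adj X (\<tau> y) (a x)"
        using \<tau>[OF y(1,2)] \<tau>[OF ax] adj_sym by auto
      then have "y = a x" by (rule p_inj) (simp add: y(2) ax(2))
      then show "z = z'" using cov_orbit_act[OF a(1) x(1)] x(3) y(3) by simp
    qed
    show "image \<tau> ` {z \<in> quotient. proj z = v} \<subseteq> {z \<in> quotient. proj z = w}"
    proof
      fix z assume "z \<in> image \<tau> ` {z \<in> quotient. proj z = v}"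
      then obtain x where x: "x \<in> verts X" "p x = v" "z = \<tau> ` cov_orbit x"
        unfolding quotient_def by (auto simp: proj_cov_orbit)
      then have "z = cov_orbit (\<tau> x)" "\<tau> x \<in> verts X" "p (\<tau> x) = w"
        using image[OF x(1,2)] \<tau>[OF x(1,2)] adj_verts(2)[of x "\<tau> x"] by auto
      then show "z \<in> {z \<in> quotient. proj z = w}" unfolding quotient_def by (simp add: proj_cov_orbit)
    qed
  qed (simp add: finite_quotient)
qed

text \<open>The preceding inequality in both directions along each edge gives equality, and
  \<open>Y\<close> is connected.\<close>

lemma quotient_degree:
  "\<exists>D>0. \<forall>v\<in>verts Y. card {z \<in> quotient. proj z = v} = D"
proof -
  obtain x0 where x0: "x0 \<in> verts X" using conn by (auto simp: connected_graph_def)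
  have walk: "card {z \<in> quotient. proj z = v} = card {z \<in> quotient. proj z = p x0}"
    if "(adj Y)\<^sup>*\<^sup>* (p x0) v" for v
    using that
  proof (induction rule: rtranclp_induct)
    case (step v w)
    have "adj Y w v" using Y_simple step.hyps(2) unfolding simple_graph_def by blast
    from card_quotient_adj_le[OF this] card_quotient_adj_le[OF step.hyps(2)] step.IH
    show ?case by simp
  qed simp
  have "\<forall>v\<in>verts Y. card {z \<in> quotient. proj z = v} = card {z \<in> quotient. proj z = p x0}"
    by (intro ballI walk) (use Y_conn p_verts[OF x0] in \<open>simp add: connected_graph_def\<close>)
  moreover have "cov_orbit x0 \<in> {z \<in> quotient. proj z = p x0}"
    using x0 unfolding quotient_def by (simp add: proj_cov_orbit)
  then have "card {z \<in> quotient. proj z = p x0} > 0"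
    using finite_quotient by (intro card_gt_0_iff[THEN iffD2]) auto
  ultimately show ?thesis by blast
qed

end


section \<open>A Poincare inequality\<close>

text \<open>The sum runs over ordered pairs, so each edge of a simple graph counts twice.\<close>

definition dirichlet_energy :: "'w ugraph \<Rightarrow> ('w \<Rightarrow> real) \<Rightarrow> real" where
  "dirichlet_energy Y f = (\<Sum>v\<in>verts Y. \<Sum>w\<in>neighbors Y v. (f v - f w)\<^sup>2)"

text \<open>The factor 2 comes from the triangle inequality for squares, \<open>m\<close> from the
  number of representatives, and \<open>(k + 1) ^ m\<close> from comparing their stabilizers with
  that of \<open>x0\<close>. In the last factor, the first term pays for the walk from
  \<open>x0\<close> to a representative, the second for the walk from \<open>x0\<close> to its
  translate by an element of \<open>Q\<close>, divided by the squared Kazhdan constant.\<close>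

definition poincare_constant :: "nat \<Rightarrow> nat \<Rightarrow> nat \<Rightarrow> real \<Rightarrow> real" where
  "poincare_constant k m r \<epsilon> =
     2 * real m * real ((k + 1) ^ m) * (real ((4 * (k + 1)) ^ m) + real ((4 * (k + 1)) ^ r) / \<epsilon>\<^sup>2)"

lemma sum_UN_le:
  fixes g :: "'a \<Rightarrow> real"
  assumes "finite S" "\<And>y. y \<in> S \<Longrightarrow> finite (B y)" "\<And>z. 0 \<le> g z"
  shows "sum g (\<Union>y\<in>S. B y) \<le> (\<Sum>y\<in>S. sum g (B y))"
  using assms(1,2)
proof (induction S)
  case (insert y S)
  then have "sum g (B y \<union> (\<Union>y\<in>S. B y)) \<le> sum g (B y) + sum g (\<Union>y\<in>S. B y)"
    by (subst sum_Un) (auto intro!: sum_nonneg assms(3))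
  then show ?case using insert by simp
qed simp

lemma sum_sq_diff_triangle:
  fixes a b c :: "'a \<Rightarrow> real"
  shows "(\<Sum>t\<in>T. (a t - c t)\<^sup>2) \<le> 2 * (\<Sum>t\<in>T. (a t - b t)\<^sup>2) + 2 * (\<Sum>t\<in>T. (b t - c t)\<^sup>2)"
proof -
  have "(a t - c t)\<^sup>2 \<le> 2 * (a t - b t)\<^sup>2 + 2 * (b t - c t)\<^sup>2" for t
  proof -
    have "0 \<le> ((a t - b t) - (b t - c t))\<^sup>2" by simp
    then show ?thesis by (simp add: power2_eq_square algebra_simps)
  qed
  then have "(\<Sum>t\<in>T. (a t - c t)\<^sup>2) \<le> (\<Sum>t\<in>T. 2 * (a t - b t)\<^sup>2 + 2 * (b t - c t)\<^sup>2)"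
    by (intro sum_mono)
  then show ?thesis by (simp add: sum.distrib sum_distrib_left)
qed

context finite_index_covering
begin

lemma sum_quotient:
  "\<exists>D>0. \<forall>g :: 'w \<Rightarrow> real. (\<Sum>z\<in>quotient. g (proj z)) = D * (\<Sum>v\<in>verts Y. g v)"
proof -
  obtain D :: nat where D: "D > 0" "\<forall>v\<in>verts Y. card {z \<in> quotient. proj z = v} = D"
    using quotient_degree by blast
  have "(\<Sum>z\<in>quotient. g (proj z)) = real D * (\<Sum>v\<in>verts Y. g v)" for g :: "'w \<Rightarrow> real"
  proof -
    have "proj ` quotient \<subseteq> verts Y"
      unfolding quotient_def using p_verts by (auto simp: proj_cov_orbit)
    then have "(\<Sum>z\<in>quotient. g (proj z))
        = (\<Sum>v\<in>verts Y. \<Sum>z\<in>{z \<in> quotient. proj z = v}. g (proj z))"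
      by (rule sum.group[OF finite_quotient Y_finite, symmetric])
    also have "\<dots> = (\<Sum>v\<in>verts Y. real D * g v)"
      using D(2) by (intro sum.cong refl) simp
    finally show ?thesis by (simp add: sum_distrib_left)
  qed
  then show ?thesis using D(1) by (intro exI[of _ "real D"]) simp
qed

section \<open>Sums over the transversal against sums over \<open>Y\<close>, up to the common degree
  \<open>D\<close>\<close>

context
  fixes D :: real
  assumes D_pos: "D > 0"
    and D: "\<And>g :: 'w \<Rightarrow> real. (\<Sum>z\<in>quotient. g (proj z)) = D * (\<Sum>v\<in>verts Y. g v)"
begin

lemma sum_transversal_proj:
  fixes g :: "'w \<Rightarrow> real"
  assumes x: "x \<in> verts X"
  shows "(\<Sum>t\<in>transversal. g (p (t x)))
       = card (stab x) * (\<Sum>z\<in>(\<lambda>t. cov_orbit (t x)) ` transversal. g (proj z))"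
proof -
  have "(\<Sum>t\<in>transversal. g (p (t x))) = (\<Sum>t\<in>transversal. g (proj (cov_orbit (t x))))"
    by (intro sum.cong refl) (simp add: proj_cov_orbit[OF act_closed[OF transversal_carrier x]])
  then show ?thesis using sum_transversal[OF x, of "\<lambda>z. g (proj z)"] by simp
qed

lemma sum_transversal_le:
  fixes g :: "'w \<Rightarrow> real"
  assumes x: "x \<in> verts X" and g: "\<And>v. 0 \<le> g v"
  shows "(\<Sum>t\<in>transversal. g (p (t x))) \<le> card (stab x) * (D * (\<Sum>v\<in>verts Y. g v))"
  unfolding sum_transversal_proj[OF x] D[symmetric]
  by (intro mult_left_mono sum_mono2 finite_quotient quotient_sub x g) simp

text \<open>The translates of the representatives cover the quotient. Division by
  \<open>card (stab y)\<close> undoes the multiplicity, and overlaps only enlarge the right side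
  since \<open>g\<close> is nonnegative.\<close>

lemma le_sum_transversal:
  fixes g :: "'w \<Rightarrow> real"
  assumes S: "finite S" "S \<subseteq> verts X" "\<forall>x\<in>verts X. \<exists>y\<in>S. x \<in> orb y" and g: "\<And>v. 0 \<le> g v"
  shows "D * (\<Sum>v\<in>verts Y. g v) \<le> (\<Sum>y\<in>S. (\<Sum>t\<in>transversal. g (p (t y))) / card (stab y))"
proof -
  let ?B = "\<lambda>y. (\<lambda>t. cov_orbit (t y)) ` transversal"
  have "D * (\<Sum>v\<in>verts Y. g v) = (\<Sum>z\<in>quotient. g (proj z))" by (rule D[symmetric])
  also have "\<dots> \<le> (\<Sum>z\<in>(\<Union>y\<in>S. ?B y). g (proj z))"
    using S by (intro sum_mono2 quotient_cover g) (auto simp: finite_transversal)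
  also have "\<dots> \<le> (\<Sum>y\<in>S. \<Sum>z\<in>?B y. g (proj z))"
    by (intro sum_UN_le S(1) finite_imageI finite_transversal g)
  also have "\<dots> = (\<Sum>y\<in>S. (\<Sum>t\<in>transversal. g (p (t y))) / card (stab y))"
  proof (intro sum.cong refl)
    fix y assume "y \<in> S"
    then have y: "y \<in> verts X" using S by blast
    show "(\<Sum>z\<in>?B y. g (proj z)) = (\<Sum>t\<in>transversal. g (p (t y))) / card (stab y)"
      unfolding sum_transversal_proj[OF y] using card_stab_pos[OF y] by simp
  qed
  finally show ?thesis .
qed

text \<open>Each \<open>t\<close> carries the edge to an edge that \<open>p\<close> projects to
  \<open>Y\<close>, so the left term is one summand of the energy at \<open>p (t x)\<close>.\<close>

lemma dist_edge:
  assumes xy: "adj X x y"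
  shows "(\<Sum>t\<in>transversal. (f (p (t x)) - f (p (t y)))\<^sup>2)
       \<le> card (stab x) * (D * dirichlet_energy Y f)"
proof -
  have V: "x \<in> verts X" "y \<in> verts X" using adj_verts[OF xy] by auto
  have "(\<Sum>t\<in>transversal. (f (p (t x)) - f (p (t y)))\<^sup>2)
      \<le> (\<Sum>t\<in>transversal. \<Sum>w\<in>neighbors Y (p (t x)). (f (p (t x)) - f w)\<^sup>2)"
  proof (intro sum_mono)
    fix t assume "t \<in> transversal"
    then have t: "t \<in> carrier G" by (rule transversal_carrier)
    have "adj Y (p (t x)) (p (t y))" by (rule p_adj[OF iffD2[OF act_adj[OF t V] xy]])
    then have "p (t y) \<in> neighbors Y (p (t x))" by (simp add: neighbors_def)
    moreover have "finite (neighbors Y (p (t x)))"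
      using Y_reg p_verts[OF act_closed[OF t V(1)]] by (simp add: regular_def)
    ultimately show "(f (p (t x)) - f (p (t y)))\<^sup>2 \<le> (\<Sum>w\<in>neighbors Y (p (t x)). (f (p (t x)) - f w)\<^sup>2)"
      by (intro member_le_sum[where f = "\<lambda>w. (f (p (t x)) - f w)\<^sup>2"]) auto
  qed
  also have "\<dots> \<le> card (stab x) * (D * dirichlet_energy Y f)"
    unfolding dirichlet_energy_def
    by (rule sum_transversal_le[OF V(1), of "\<lambda>v. \<Sum>w\<in>neighbors Y v. (f v - f w)\<^sup>2"])
      (simp add: sum_nonneg)
  finally show ?thesis .
qed

lemma dirichlet_energy_nonneg: "0 \<le> dirichlet_energy Y f"
  unfolding dirichlet_energy_def by (intro sum_nonneg) simp

text \<open>The base \<open>4 * (k + 1)\<close> makes the induction close. The last edge is measured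
  by the stabilizer of its start \<open>z\<close>, which costs \<open>(k + 1) ^ n\<close> and is
  absorbed in the bound already present; the triangle inequality for squares then turns two equal
  bounds into four times one.\<close>

lemma dist_walk:
  "(adj X ^^ n) x y \<Longrightarrow>
    (\<Sum>t\<in>transversal. (f (p (t x)) - f (p (t y)))\<^sup>2)
       \<le> real ((4 * (k + 1)) ^ n) * (card (stab x) * (D * dirichlet_energy Y f))"
proof (induction n arbitrary: y)
  case 0
  then show ?case using D_pos dirichlet_energy_nonneg[of f] by simp
next
  case (Suc n)
  then obtain z where z: "(adj X ^^ n) x z" "adj X z y" by auto
  let ?M = "card (stab x) * (D * dirichlet_energy Y f)"
  let ?B = "real ((4 * (k + 1)) ^ n)"
  have E: "0 \<le> D * dirichlet_energy Y f" using D_pos dirichlet_energy_nonneg[of f] by simp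
  have M: "0 \<le> ?M" using E by simp
  have "real (card (stab z)) \<le> real ((k + 1) ^ n * card (stab x))"
    using card_stab_walk[OF z(1)] by (rule of_nat_mono)
  also have "\<dots> \<le> ?B * card (stab x)"
    unfolding of_nat_mult by (intro mult_right_mono of_nat_mono power_mono) auto
  finally have "card (stab z) * (D * dirichlet_energy Y f)
      \<le> ?B * card (stab x) * (D * dirichlet_energy Y f)"
    using E by (intro mult_right_mono)
  with dist_edge[OF z(2), of f]
  have zy: "(\<Sum>t\<in>transversal. (f (p (t z)) - f (p (t y)))\<^sup>2) \<le> ?B * ?M" by simp
  have "(\<Sum>t\<in>transversal. (f (p (t x)) - f (p (t y)))\<^sup>2) \<le> 2 * (?B * ?M) + 2 * (?B * ?M)"
    using sum_sq_diff_triangle[of "\<lambda>t. f (p (t x))" "\<lambda>t. f (p (t y))" transversal "\<lambda>t. f (p (t z))"]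
      Suc.IH[OF z(1)] zy by linarith
  also have "\<dots> = 4 * (?B * ?M)" by simp
  also have "\<dots> \<le> (4 * (k + 1)) * (?B * ?M)"
    using M by (intro mult_right_mono) auto
  finally show ?case by (simp add: mult.assoc)
qed

text \<open>The permutation gap is applied to the centred function
  \<open>t \<mapsto> f (p (t x0))\<close> on the transversal. Right multiplication by
  \<open>q\<close> replaces \<open>x0\<close> by \<open>q x0\<close>, and a walk of length at most
  \<open>r\<close> bounds the change by the energy.\<close>

lemma spectral_gap:
  fixes f :: "'w \<Rightarrow> real"
  assumes kazhdan: "kazhdan_pair G Q \<epsilon>" and x0: "x0 \<in> verts X"
    and displacement: "\<forall>g\<in>Q. \<exists>n\<le>r. (adj X ^^ n) x0 (g x0)"
  shows "\<exists>c. (\<Sum>t\<in>transversal. (f (p (t x0)) - c)\<^sup>2)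
      \<le> real ((4 * (k + 1)) ^ r) / \<epsilon>\<^sup>2 * (card (stab x0) * (D * dirichlet_energy Y f))"
proof -
  let ?M = "card (stab x0) * (D * dirichlet_energy Y f)"
  have eps: "\<epsilon> > 0" and QG: "Q \<subseteq> carrier G" using kazhdan by (auto simp: kazhdan_pair_def)
  have M: "0 \<le> ?M" using D_pos dirichlet_energy_nonneg[of f] by simp
  define F where "F t = f (p (t x0))" for t
  \<comment> \<open>The mean, so that the centred function has sum zero.\<close>
  define c where "c = sum F transversal / card transversal"
  \<comment> \<open>The pairing with \<open>0\<close> moves the index set into the type that \<open>kazhdan_pair\<close> quantifies over.\<close>
  define T where "T = (\<lambda>t. (t, 0 :: nat)) ` transversal"
  define \<tau> where "\<tau> g s = (coset_rep (fst s \<otimes> g), 0 :: nat)" for g and s :: "('v \<Rightarrow> 'v) \<times> nat"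
  define u where "u s = F (fst s) - c" for s :: "('v \<Rightarrow> 'v) \<times> nat"
  have F_rep: "F (coset_rep g) = F g" if "g \<in> carrier G" for g
    unfolding F_def using p_coset_rep[OF that x0] by simp
  have sum_T: "(\<Sum>s\<in>T. h s) = (\<Sum>t\<in>transversal. h (t, 0))" for h :: "('v \<Rightarrow> 'v) \<times> nat \<Rightarrow> real"
    unfolding T_def by (subst sum.reindex) (auto simp: inj_on_def)
  have "card transversal > 0"
    using finite_transversal transversal_nonempty by (simp add: card_gt_0_iff)
  then have u0: "sum u T = 0" unfolding sum_T u_def by (simp add: sum_subtractf c_def)
  show ?thesis
  proof (cases "\<exists>s\<in>T. u s \<noteq> 0")
    \<comment> \<open>The gap needs a nonzero vector; here the variance is zero and the bound is
      immediate.\<close>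
    case False
    then have "F t = c" if "t \<in> transversal" for t using that by (auto simp: T_def u_def)
    then have "(\<Sum>t\<in>transversal. (f (p (t x0)) - c)\<^sup>2) = 0" unfolding F_def by simp
    then show ?thesis using M by (intro exI[of _ c]) simp
  next
    case True
    have "\<exists>q\<in>Q. \<epsilon>\<^sup>2 * (\<Sum>s\<in>T. (u s)\<^sup>2) \<le> (\<Sum>s\<in>T. (u (\<tau> q s) - u s)\<^sup>2)"
    proof (rule kazhdan_pair_permutation_gap[OF is_group kazhdan _ _ _ _ _ u0 True])
      show "finite T" by (simp add: T_def finite_transversal)
    next
      fix g s assume "g \<in> carrier G" "s \<in> T"
      then show "\<tau> g s \<in> T"
        using transversal_carrier by (auto simp: T_def \<tau>_def coset_rep_in)
    next
      fix s assume "s \<in> T"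
      then show "\<tau> \<one> s = s"
        using transversal_carrier by (auto simp: T_def \<tau>_def coset_rep_transversal)
    next
      fix g h s assume "g \<in> carrier G" "h \<in> carrier G" "s \<in> T"
      then show "\<tau> (g \<otimes> h) s = \<tau> h (\<tau> g s)"
        using transversal_carrier by (auto simp: T_def \<tau>_def coset_rep_mult m_assoc)
    next
      fix s s' assume "s \<in> T" "s' \<in> T"
      then obtain t t' where t: "s = (t, 0)" "s' = (t', 0)" "t \<in> transversal" "t' \<in> transversal"
        by (auto simp: T_def)
      have G: "t \<in> carrier G" "t' \<in> carrier G" using transversal_carrier t by auto
      have "t \<otimes> (inv t \<otimes> t') = t'" using G by (simp flip: m_assoc)
      then have "\<tau> (inv t \<otimes> t') s = s'" using t by (simp add: \<tau>_def coset_rep_transversal)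
      then show "\<exists>g\<in>carrier G. \<tau> g s = s'" using G by (intro bexI[of _ "inv t \<otimes> t'"]) simp_all
    qed
    then obtain q where q: "q \<in> Q"
      and gap: "\<epsilon>\<^sup>2 * (\<Sum>s\<in>T. (u s)\<^sup>2) \<le> (\<Sum>s\<in>T. (u (\<tau> q s) - u s)\<^sup>2)" by blast
    have qG: "q \<in> carrier G" using q QG by blast
    obtain n where n: "n \<le> r" "(adj X ^^ n) x0 (q x0)" using bspec[OF displacement q] by (elim exE conjE)
    have "(\<Sum>s\<in>T. (u (\<tau> q s) - u s)\<^sup>2)
        = (\<Sum>t\<in>transversal. (f (p (t x0)) - f (p (t (q x0))))\<^sup>2)"
      unfolding sum_T
    proof (intro sum.cong refl)
      fix t assume "t \<in> transversal"
      then have t: "t \<in> carrier G" by (rule transversal_carrier)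
      \<comment> \<open>Passing to the representative of \<open>t \<otimes> q\<close> changes it by
        a left factor in \<open>\<Lambda>\<close>, which \<open>p\<close> does not see.\<close>
      have "u (\<tau> q (t, 0)) = F (t \<otimes> q) - c" using F_rep t qG by (simp add: u_def \<tau>_def)
      then have "u (\<tau> q (t, 0)) = f (p (t (q x0))) - c"
        by (simp add: F_def act_mult[OF t qG x0])
      then show "(u (\<tau> q (t, 0)) - u (t, 0))\<^sup>2 = (f (p (t x0)) - f (p (t (q x0))))\<^sup>2"
        by (simp add: u_def F_def power2_commute)
    qed
    also have "\<dots> \<le> real ((4 * (k + 1)) ^ n) * ?M" by (rule dist_walk[OF n(2)])
    also have "\<dots> \<le> real ((4 * (k + 1)) ^ r) * ?M"
      using n(1) M by (intro mult_right_mono of_nat_mono power_increasing) auto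
    finally have "\<epsilon>\<^sup>2 * (\<Sum>t\<in>transversal. (f (p (t x0)) - c)\<^sup>2) \<le> real ((4 * (k + 1)) ^ r) * ?M"
      using gap unfolding sum_T u_def F_def by simp
    then show ?thesis using eps by (intro exI[of _ c]) (simp add: field_simps)
  qed
qed

end

text \<open>The variance bound at \<open>x0\<close> is carried along walks to every representative
  with the same centre \<open>c\<close>, and the representatives together account for all of
  \<open>Y\<close>.\<close>

lemma poincare_inequality:
  fixes f :: "'w \<Rightarrow> real"
  assumes kazhdan: "kazhdan_pair G Q \<epsilon>" and x0: "x0 \<in> verts X"
    and displacement: "\<forall>g\<in>Q. \<exists>n\<le>r. (adj X ^^ n) x0 (g x0)"
  shows "\<exists>c. (\<Sum>v\<in>verts Y. (f v - c)\<^sup>2)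
      \<le> poincare_constant k (card (orbit_space X \<Gamma>)) r \<epsilon> * dirichlet_energy Y f"
proof -
  obtain D :: real where D: "D > 0"
    "\<And>g :: 'w \<Rightarrow> real. (\<Sum>z\<in>quotient. g (proj z)) = D * (\<Sum>v\<in>verts Y. g v)"
    using sum_quotient by (elim exE conjE) simp
  define m where "m = card (orbit_space X \<Gamma>)"
  define E where "E = dirichlet_energy Y f"
  define b where "b = real ((4 * (k + 1)) ^ m)"
  define b' where "b' = real ((4 * (k + 1)) ^ r) / \<epsilon>\<^sup>2"
  have E: "0 \<le> E" unfolding E_def by (rule dirichlet_energy_nonneg[OF D])
  have b: "0 \<le> b + b'" unfolding b_def b'_def by simp
  from spectral_gap[OF D kazhdan x0 displacement, of f]
  obtain c where c: "(\<Sum>t\<in>transversal. (f (p (t x0)) - c)\<^sup>2) \<le> b' * (card (stab x0) * (D * E))"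
    unfolding b'_def E_def by blast
  from orbit_representatives[OF x0]
  obtain S where S: "finite S" "card S \<le> m" "\<forall>y\<in>S. \<exists>n\<le>m. (adj X ^^ n) x0 y"
    "\<forall>x\<in>verts X. \<exists>y\<in>S. x \<in> orb y"
    unfolding m_def by (elim exE conjE)
  have SV: "S \<subseteq> verts X" using S(3) walk_verts[OF _ x0] by blast
  have y: "(\<Sum>t\<in>transversal. (f (p (t y)) - c)\<^sup>2) / card (stab y)
      \<le> 2 * real ((k + 1) ^ m) * (b + b') * (D * E)" if y: "y \<in> S" for y
  proof -
    obtain n where n: "n \<le> m" "(adj X ^^ n) x0 y" using bspec[OF S(3) y] by (elim exE conjE)
    have yV: "y \<in> verts X" using SV y by blast
    have "(\<Sum>t\<in>transversal. (f (p (t y)) - f (p (t x0)))\<^sup>2)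
        = (\<Sum>t\<in>transversal. (f (p (t x0)) - f (p (t y)))\<^sup>2)"
      by (intro sum.cong refl power2_commute)
    also have "\<dots> \<le> real ((4 * (k + 1)) ^ n) * (card (stab x0) * (D * E))"
      unfolding E_def by (rule dist_walk[OF D n(2)])
    also have "\<dots> \<le> b * (card (stab x0) * (D * E))"
      unfolding b_def using n(1) D(1) E
      by (intro mult_right_mono of_nat_mono power_increasing) auto
    finally have "(\<Sum>t\<in>transversal. (f (p (t y)) - c)\<^sup>2)
        \<le> 2 * (b * (card (stab x0) * (D * E))) + 2 * (b' * (card (stab x0) * (D * E)))"
      using sum_sq_diff_triangle[of "\<lambda>t. f (p (t y))" "\<lambda>_. c" transversal "\<lambda>t. f (p (t x0))"] c
      by linarith
    also have "\<dots> = real (card (stab x0)) * (2 * (b + b') * (D * E))"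
      by (simp add: algebra_simps)
    \<comment> \<open>The stabilizer of \<open>x0\<close> is traded for that of \<open>y\<close>,
      which the weight \<open>1 / card (stab y)\<close> then cancels.\<close>
    also have "\<dots> \<le> (real ((k + 1) ^ m) * card (stab y)) * (2 * (b + b') * (D * E))"
    proof (rule mult_right_mono)
      have "card (stab x0) \<le> (k + 1) ^ n * card (stab y)"
        by (rule card_stab_walk[OF walk_sym[OF n(2)]])
      also have "\<dots> \<le> (k + 1) ^ m * card (stab y)"
        using n(1) by (intro mult_right_mono power_increasing) auto
      finally show "real (card (stab x0)) \<le> real ((k + 1) ^ m) * card (stab y)"
        by (metis of_nat_le_iff of_nat_mult)
    qed (use b D(1) E in simp)
    finally show ?thesis using card_stab_pos[OF yV] by (simp add: field_simps)
  qed
  have "D * (\<Sum>v\<in>verts Y. (f v - c)\<^sup>2)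
      \<le> (\<Sum>y\<in>S. (\<Sum>t\<in>transversal. (f (p (t y)) - c)\<^sup>2) / card (stab y))"
    by (rule le_sum_transversal[OF D S(1) SV S(4)]) simp
  also have "\<dots> \<le> (\<Sum>y\<in>S. 2 * real ((k + 1) ^ m) * (b + b') * (D * E))"
    by (rule sum_mono) (rule y)
  also have "\<dots> = real (card S) * (2 * real ((k + 1) ^ m) * (b + b') * (D * E))" by simp
  also have "\<dots> \<le> real m * (2 * real ((k + 1) ^ m) * (b + b') * (D * E))"
    using S(2) b D(1) E by (intro mult_right_mono) simp_all
  also have "\<dots> = D * (poincare_constant k m r \<epsilon> * E)"
    unfolding poincare_constant_def b_def b'_def by simp
  \<comment> \<open>The degree \<open>D\<close> stands on both sides and cancels.\<close>
  finally have "(\<Sum>v\<in>verts Y. (f v - c)\<^sup>2) \<le> poincare_constant k m r \<epsilon> * E"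
    using D(1) by (simp only: mult_le_cancel_left_pos)
  then show ?thesis unfolding m_def E_def by blast
qed

end


section \<open>Expansion\<close>

text \<open>Only ordered pairs crossing between \<open>A\<close> and its complement contribute.
  Those ending in \<open>A\<close> start at a boundary vertex, which has \<open>k\<close>
  neighbours; reversal shows that the others are equally many.\<close>

lemma dirichlet_energy_indicator_le:
  assumes simple: "simple_graph Y" and fin: "finite (verts Y)" and reg: "regular Y k"
  shows "dirichlet_energy Y (indicator A) \<le> 2 * real k * real (card (boundary Y A))"
proof -
  let ?in = "\<lambda>v w. if v \<notin> A \<and> w \<in> A then 1 else 0 :: real"
  have nbrs: "neighbors Y v = {w. w \<in> verts Y \<and> adj Y v w}"
    "neighbors Y v = {w. w \<in> verts Y \<and> adj Y w v}" for v
    using simple by (auto simp: neighbors_def simple_graph_def)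
  have entering: "(\<Sum>v\<in>verts Y. \<Sum>w\<in>neighbors Y v. ?in v w) \<le> real k * real (card (boundary Y A))"
  proof -
    have "(\<Sum>v\<in>verts Y. \<Sum>w\<in>neighbors Y v. ?in v w)
        = (\<Sum>v\<in>boundary Y A. \<Sum>w\<in>neighbors Y v. ?in v w)"
      using simple fin
      by (intro sum.mono_neutral_right ballI sum.neutral)
        (auto simp: boundary_def neighbors_def simple_graph_def)
    also have "\<dots> \<le> (\<Sum>v\<in>boundary Y A. \<Sum>w\<in>neighbors Y v. 1)"
      by (intro sum_mono) simp
    also have "\<dots> = (\<Sum>v\<in>boundary Y A. real k)"
      using reg by (intro sum.cong refl) (simp add: boundary_def regular_def)
    finally show ?thesis by (simp add: mult.commute)
  qed
  have "(\<Sum>v\<in>verts Y. \<Sum>w\<in>neighbors Y v. ?in w v) = (\<Sum>v\<in>verts Y. \<Sum>w\<in>neighbors Y v. ?in v w)"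
    using sum.swap_restrict[OF fin fin, of "\<lambda>v w. ?in w v" "adj Y"] nbrs by (simp only:)
  moreover have "dirichlet_energy Y (indicator A)
      = (\<Sum>v\<in>verts Y. \<Sum>w\<in>neighbors Y v. ?in v w + ?in w v)"
    unfolding dirichlet_energy_def by (intro sum.cong refl) (auto simp: indicator_def)
  ultimately have "dirichlet_energy Y (indicator A)
      = 2 * (\<Sum>v\<in>verts Y. \<Sum>w\<in>neighbors Y v. ?in v w)"
    by (simp add: sum.distrib)
  then show ?thesis using entering by linarith
qed

text \<open>Completing the square in \<open>c\<close>: the minimum is at the mean
  \<open>card A / card V\<close>, where the sum equals the left side.\<close>

lemma variance_indicator_ge:
  assumes fin: "finite V" and A: "A \<subseteq> V"
  shows "(1 - real (card A) / real (card V)) * real (card A) \<le> (\<Sum>v\<in>V. (indicator A v - c)\<^sup>2)"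
proof (cases "card V = 0")
  case True
  then show ?thesis using fin A by auto
next
  case False
  let ?a = "real (card A)" and ?n = "real (card V)"
  have "sum (indicator A) V = ?a"
    using A fin by (simp add: indicator_def sum_of_bool_eq Int_absorb1)
  then have sum_A: "(\<Sum>v\<in>V. indicator A v * d) = ?a * d" for d :: real
    by (simp flip: sum_distrib_right)
  have "(\<Sum>v\<in>V. (indicator A v - c)\<^sup>2) = (\<Sum>v\<in>V. indicator A v * (1 - 2 * c) + c\<^sup>2)"
    by (intro sum.cong refl) (simp add: indicator_def power2_eq_square algebra_simps)
  also have "\<dots> = ?a * (1 - 2 * c) + ?n * c\<^sup>2"
    by (simp add: sum.distrib sum_A)
  also have "\<dots> = (1 - ?a / ?n) * ?a + ?n * (c - ?a / ?n)\<^sup>2"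
    using False by (simp add: power2_eq_square field_simps)
  finally show ?thesis by simp
qed

lemma boundary_nonempty:
  assumes conn: "connected_graph Y" and simple: "simple_graph Y"
    and A: "A \<subseteq> verts Y" "A \<noteq> {}" "A \<noteq> verts Y"
  shows "boundary Y A \<noteq> {}"
proof
  assume empty: "boundary Y A = {}"
  obtain u where u: "u \<in> A" using A(2) by blast
  have "v \<in> A" if "(adj Y)\<^sup>*\<^sup>* u v" for v
    using that
  proof (induction rule: rtranclp_induct)
    case (step v w)
    then show ?case using empty simple unfolding boundary_def simple_graph_def by blast
  qed (rule u)
  then have "verts Y \<subseteq> A" using conn u A(1) unfolding connected_graph_def by blast
  then show False using A by blast
qed

lemma covering_map_surj:
  assumes cov: "covering_map X Y p" and ne: "verts X \<noteq> {}"
    and simple: "simple_graph X" and conn: "connected_graph Y"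
  shows "p ` verts X = verts Y"
proof
  show "p ` verts X \<subseteq> verts Y" using cov by (simp add: covering_map_def)
  obtain x0 where x0: "x0 \<in> verts X" using ne by blast
  have "v \<in> p ` verts X" if "(adj Y)\<^sup>*\<^sup>* (p x0) v" for v
    using that
  proof (induction rule: rtranclp_induct)
    case (step v w)
    then obtain x where x: "x \<in> verts X" "v = p x" by blast
    then have "w \<in> p ` neighbors X x"
      using cov step.hyps(2) by (simp add: covering_map_def bij_betw_def neighbors_def)
    then show ?case using simple by (auto simp: neighbors_def simple_graph_def)
  qed (use x0 in simp)
  moreover have "p x0 \<in> verts Y" using x0 cov by (auto simp: covering_map_def)
  ultimately show "verts Y \<subseteq> p ` verts X" using conn unfolding connected_graph_def by blast
qed

text \<open>Here \<open>p\<close> is constant on the orbits of \<open>\<Gamma>\<close>, so the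
  surjection onto \<open>verts Y\<close> factors through the orbit space.\<close>

lemma (in graph_group) card_verts_le_orbits:
  assumes cov: "covering_map X Y p" and conn_Y: "connected_graph Y" and sub: "\<Gamma> \<subseteq> Cov X p"
  shows "card (verts Y) \<le> card (orbit_space X \<Gamma>)"
proof (rule surj_card_le[OF fin_orbits, of _ "\<lambda>A. p (SOME x. x \<in> A)"], rule subsetI)
  fix v assume "v \<in> verts Y"
  then have "v \<in> p ` verts X"
    using covering_map_surj[OF cov _ simple conn_Y] conn by (simp add: connected_graph_def)
  then obtain x where x: "x \<in> verts X" "v = p x" by blast
  have "(SOME y. y \<in> orb x) \<in> orb x"
    by (rule someI[of "\<lambda>y. y \<in> orb x"]) (rule mem_orbit_self[OF x(1)])
  then obtain g where g: "g \<in> carrier G" "(SOME y. y \<in> orb x) = g x"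
    unfolding orbit_def by blast
  then have "g \<in> Cov X p" using sub carrier_eq by blast
  then have "p (SOME y. y \<in> orb x) = v" using g(2) x by (simp add: Cov_def)
  then show "v \<in> (\<lambda>A. p (SOME x. x \<in> A)) ` orbit_space X \<Gamma>"
    unfolding orbit_space_eq using x(1) by (intro image_eqI[of _ _ "orb x"]) auto
qed

section \<open>The expanding constant and the two cases of the theorem\<close>

text \<open>One constant for both cases: \<open>m\<close> serves
  \<open>\<Gamma> \<subseteq> Cov X p\<close>, the Poincare term serves finite index, and the 1
  keeps the denominator positive.\<close>

definition expanding_constant :: "nat \<Rightarrow> nat \<Rightarrow> nat \<Rightarrow> real \<Rightarrow> real" where
  "expanding_constant k m r \<epsilon> = 1 / (1 + real m + 2 * real k * poincare_constant k m r \<epsilon>)"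

lemma poincare_constant_nonneg: "0 \<le> poincare_constant k m r \<epsilon>"
  unfolding poincare_constant_def by simp

lemma expanding_constant_pos: "0 < expanding_constant k m r \<epsilon>"
  unfolding expanding_constant_def using poincare_constant_nonneg[of k m r \<epsilon>]
  by (simp add: add_pos_nonneg)

lemma expanding_constant_mult_le:
  assumes "0 \<le> b" "x \<le> (real m + 2 * real k * poincare_constant k m r \<epsilon>) * b"
  shows "expanding_constant k m r \<epsilon> * x \<le> b"
proof -
  let ?K = "real m + 2 * real k * poincare_constant k m r \<epsilon>"
  have K: "0 \<le> ?K" using poincare_constant_nonneg[of k m r \<epsilon>] by simp
  have "x \<le> (1 + ?K) * b" using assms by (simp add: algebra_simps)
  then show ?thesis
    using K unfolding expanding_constant_def by (simp add: pos_divide_le_eq mult.commute add.assoc)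
qed

text \<open>Connectedness makes the \<open>LEAST\<close> in \<open>graph_dist\<close> attained by an
  actual walk.\<close>

lemma (in graph_group) walk_of_graph_dist:
  assumes "x \<in> verts X" "g \<in> carrier G" "graph_dist X x (g x) \<le> r"
  shows "\<exists>n\<le>r. (adj X ^^ n) x (g x)"
proof -
  have "(adj X)\<^sup>*\<^sup>* x (g x)"
    using conn assms(1) act_closed[OF assms(2,1)] unfolding connected_graph_def by blast
  then obtain n where "(adj X ^^ n) x (g x)" by (auto simp: rtranclp_power)
  then have "(adj X ^^ graph_dist X x (g x)) x (g x)" unfolding graph_dist_def by (rule LeastI)
  then show ?thesis using assms(3) by (intro exI conjI)
qed

lemma graph_group_of_kazhdan_graph_structure:
  assumes "kazhdan_graph_structure X \<Gamma>" "connected_graph X" "regular X k"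
  shows "graph_group (aut_subgroup X \<Gamma>) X \<Gamma> k"
proof -
  have "\<Gamma> \<subseteq> graph_auts X"
    using assms(1) subgroup.subset by (fastforce simp: kazhdan_graph_structure_def aut_group_def)
  then show ?thesis
    using assms unfolding kazhdan_graph_structure_def property_T_def
    by (intro graph_group.intro graph_group_axioms.intro) auto
qed

lemma covered_graph_expander:
  assumes X: "kazhdan_graph_structure X \<Gamma>" "connected_graph X" "regular X k"
    and Y: "simple_graph Y" "finite (verts Y)" "connected_graph Y" "regular Y k"
    and cov: "covering_map X Y p"
    and cases: "\<Gamma> \<subseteq> Cov X p \<or> finite_index_subgroup (Cov X p) (aut_subgroup X \<Gamma>)"
    and kazhdan: "kazhdan_pair (aut_subgroup X \<Gamma>) Q \<epsilon>"
    and displacement: "\<exists>x\<in>verts X. \<forall>\<gamma>\<in>Q. graph_dist X x (\<gamma> x) \<le> r"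
  shows "expander Y (card (verts Y)) k (expanding_constant k (card (orbit_space X \<Gamma>)) r \<epsilon>)"
proof -
  let ?m = "card (orbit_space X \<Gamma>)"
  let ?K = "poincare_constant k ?m r \<epsilon>"
  interpret graph_group "aut_subgroup X \<Gamma>" X \<Gamma> k
    by (rule graph_group_of_kazhdan_graph_structure[OF X])
  have "(1 - real (card A) / real (card (verts Y))) * real (card A)
      \<le> (real ?m + 2 * real k * ?K) * real (card (boundary Y A))" if A: "A \<subseteq> verts Y" for A
    using cases
  proof
    assume sub: "\<Gamma> \<subseteq> Cov X p"
    show ?thesis
    proof (cases "A = {} \<or> A = verts Y")
      \<comment> \<open>In these two cases the left side is zero.\<close>
      case True
      then show ?thesis using poincare_constant_nonneg[of k ?m r \<epsilon>] by auto
    next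
      case False
      have "finite (boundary Y A)" using Y(2) by (simp add: boundary_def)
      then have one: "1 \<le> real (card (boundary Y A))"
        using boundary_nonempty[OF Y(3,1) A] False by (simp add: card_gt_0_iff Suc_leI)
      have "card A \<le> ?m"
        using card_mono[OF Y(2) A] card_verts_le_orbits[OF cov Y(3) sub] by simp
      then have "real (card A) \<le> real ?m * 1" by simp
      also have "\<dots> \<le> (real ?m + 2 * real k * ?K) * real (card (boundary Y A))"
        using one poincare_constant_nonneg[of k ?m r \<epsilon>] by (intro mult_mono) auto
      finally show ?thesis
        by (smt (verit) divide_nonneg_nonneg mult_left_le_one_le mult_nonneg_nonneg of_nat_0_le_iff
            mult_right_mono)
    qed
  next
    assume idx: "finite_index_subgroup (Cov X p) (aut_subgroup X \<Gamma>)"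
    interpret finite_index_covering "aut_subgroup X \<Gamma>" X \<Gamma> k Y p
      by unfold_locales (use cov Y idx in auto)
    obtain x0 where x0: "x0 \<in> verts X" "\<forall>\<gamma>\<in>Q. graph_dist X x0 (\<gamma> x0) \<le> r"
      using displacement by blast
    have "\<forall>g\<in>Q. \<exists>n\<le>r. (adj X ^^ n) x0 (g x0)"
    proof
      fix g assume g: "g \<in> Q"
      then have "g \<in> carrier (aut_subgroup X \<Gamma>)" using kazhdan unfolding kazhdan_pair_def by blast
      then show "\<exists>n\<le>r. (adj X ^^ n) x0 (g x0)"
        using walk_of_graph_dist[OF x0(1)] bspec[OF x0(2) g] by simp
    qed
    from poincare_inequality[OF kazhdan x0(1) this, of "indicator A"]
    obtain c where "(\<Sum>v\<in>verts Y. (indicator A v - c)\<^sup>2) \<le> ?K * dirichlet_energy Y (indicator A)"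
      by blast
    also have "\<dots> \<le> ?K * (2 * real k * real (card (boundary Y A)))"
      by (intro mult_left_mono dirichlet_energy_indicator_le Y poincare_constant_nonneg)
    also have "\<dots> \<le> (real ?m + 2 * real k * ?K) * real (card (boundary Y A))"
      by (simp add: algebra_simps)
    finally show ?thesis using variance_indicator_ge[OF Y(2) A, of c] by linarith
  qed
  then have "expanding_constant k ?m r \<epsilon> *
        ((1 - real (card A) / real (card (verts Y))) * real (card A)) \<le> real (card (boundary Y A))"
    if "A \<subseteq> verts Y" for A
    using that by (intro expanding_constant_mult_le) simp_all
  then show ?thesis using Y unfolding expander_def by (simp add: mult.assoc)
qed

theorem mainTheorem1:
  "\<exists>C :: nat \<Rightarrow> nat \<Rightarrow> nat \<Rightarrow> real \<Rightarrow> real.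
     (\<forall>k m r \<epsilon>. \<epsilon> > 0 \<longrightarrow> C k m r \<epsilon> > 0) \<and>
     (\<forall>(X :: 'v ugraph) \<Gamma> k (I :: 'i set) (Y :: 'i \<Rightarrow> 'w ugraph) p.
        kazhdan_graph_structure X \<Gamma> \<and> connected_graph X \<and> regular X k \<and>
        (\<forall>i\<in>I. simple_graph (Y i) \<and> finite (verts (Y i)) \<and> connected_graph (Y i) \<and>
               regular (Y i) k \<and> covering_map X (Y i) (p i) \<and>
               (\<Gamma> \<subseteq> Cov X (p i) \<or>
                finite_index_subgroup (Cov X (p i)) (aut_subgroup X \<Gamma>))) \<longrightarrow>
        expander_family k I Y \<and>
        (\<forall>Q \<epsilon> r. kazhdan_pair (aut_subgroup X \<Gamma>) Q \<epsilon> \<and>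
            (\<exists>x\<in>verts X. \<forall>\<gamma>\<in>Q. graph_dist X x (\<gamma> x) \<le> r) \<longrightarrow>
            expanders_with_constant (C k (card (orbit_space X \<Gamma>)) r \<epsilon>) k I Y))"
proof (intro exI[of _ expanding_constant] conjI allI impI expanding_constant_pos)
  fix X :: "'v ugraph" and \<Gamma> k and I :: "'i set" and Y :: "'i \<Rightarrow> 'w ugraph" and p
  assume hyps: "kazhdan_graph_structure X \<Gamma> \<and> connected_graph X \<and> regular X k \<and>
        (\<forall>i\<in>I. simple_graph (Y i) \<and> finite (verts (Y i)) \<and> connected_graph (Y i) \<and>
               regular (Y i) k \<and> covering_map X (Y i) (p i) \<and>
               (\<Gamma> \<subseteq> Cov X (p i) \<or>
                finite_index_subgroup (Cov X (p i)) (aut_subgroup X \<Gamma>)))"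
  have main: "expanders_with_constant (expanding_constant k (card (orbit_space X \<Gamma>)) r \<epsilon>) k I Y"
    if "kazhdan_pair (aut_subgroup X \<Gamma>) Q \<epsilon>"
      "\<exists>x\<in>verts X. \<forall>\<gamma>\<in>Q. graph_dist X x (\<gamma> x) \<le> r" for Q \<epsilon> r
    unfolding expanders_with_constant_def
  proof
    fix i assume "i \<in> I"
    then show "expander (Y i) (card (verts (Y i))) k
        (expanding_constant k (card (orbit_space X \<Gamma>)) r \<epsilon>)"
      using hyps that by (intro covered_graph_expander[where p = "p i"]) simp_all
  qed
  show "expander_family k I Y"
  proof -
    obtain Q \<epsilon> where kazhdan: "kazhdan_pair (aut_subgroup X \<Gamma>) Q \<epsilon>"
      using hyps unfolding kazhdan_graph_structure_def property_T_def by blast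
    obtain x where x: "x \<in> verts X" using hyps unfolding connected_graph_def by blast
    have "finite Q" using kazhdan by (simp add: kazhdan_pair_def)
    \<comment> \<open>The finite set \<open>Q\<close> supplies \<open>r\<close> as its largest
      displacement of \<open>x\<close>; for empty \<open>Q\<close> the unspecified
      \<open>Max\<close> is harmless, as the bound is vacuous.\<close>
    then have "\<forall>\<gamma>\<in>Q. graph_dist X x (\<gamma> x) \<le> Max ((\<lambda>\<gamma>. graph_dist X x (\<gamma> x)) ` Q)"
      by (intro ballI Max_ge) simp_all
    then have "\<exists>x'\<in>verts X. \<forall>\<gamma>\<in>Q. graph_dist X x' (\<gamma> x') \<le> Max ((\<lambda>\<gamma>. graph_dist X x (\<gamma> x)) ` Q)"
      by (rule bexI[OF _ x])
    from main[OF kazhdan this] show ?thesis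
      unfolding expander_family_def using expanding_constant_pos by blast
  qed
  show "expanders_with_constant (expanding_constant k (card (orbit_space X \<Gamma>)) r \<epsilon>) k I Y"
    if "kazhdan_pair (aut_subgroup X \<Gamma>) Q \<epsilon> \<and>
        (\<exists>x\<in>verts X. \<forall>\<gamma>\<in>Q. graph_dist X x (\<gamma> x) \<le> r)" for Q \<epsilon> r
    using that main by blast
qed

end
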